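(* Let $p$ be an odd prime and let $G$ be a finite $p$-group of nilpotency class at most $p-1$. Then $\exp(G\wedge G)$ divides $\exp(G)$. In particular, $\exp(M(G))$ divides $\exp(G)$.
   Context: Conventions: ${}^g h = ghg^{-1}$ and $[g,h]=ghg^{-1}h^{-1}$. The nonabelian tensor square $G\otimes G$ is the group generated by symbols $g\otimes h$ ($g,h\in G$) subject to the relations $gg'\otimes h=({}^g g'\otimes {}^g h)(g\otimes h)$ and $g\otimes hh'=(g\otimes h)({}^h g\otimes {}^h h')$ for all $g,g',h,h'\in G$. The exterior square is $G\wedge G=(G\otimes G)/\nabla(G)$, where $\nabla(G)$ is the subgroup generated by all $x\otimes x$, $x\in G$; the image of $g\otimes h$ is written $g\wedge h$. There is a homomorphism $\kappa:G\wedge G\to [G,G]$, $g\wedge h\mapsto [g,h]$, and $M(G)=\ker\kappa\cong H_2(G,\mathbb{Z})$ is the Schur multiplier. $\exp(X)$ denotes the exponent of a group $X$. *)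

theory Defs
  imports "HOL-Algebra.Algebra"
begin

definition comm :: "('a, 'b) monoid_scheme \<Rightarrow> 'a \<Rightarrow> 'a \<Rightarrow> 'a" where
  "comm G g h = g \<otimes>\<^bsub>G\<^esub> h \<otimes>\<^bsub>G\<^esub> inv\<^bsub>G\<^esub> g \<otimes>\<^bsub>G\<^esub> inv\<^bsub>G\<^esub> h"

definition conjg :: "('a, 'b) monoid_scheme \<Rightarrow> 'a \<Rightarrow> 'a \<Rightarrow> 'a" where
  "conjg G g x = g \<otimes>\<^bsub>G\<^esub> x \<otimes>\<^bsub>G\<^esub> inv\<^bsub>G\<^esub> g"

text \<open>Lower central series: lcs G 0 = G (i.e. gamma_1), lcs G (Suc i) = [G, lcs G i].\<close>
fun lcs :: "('a, 'b) monoid_scheme \<Rightarrow> nat \<Rightarrow> 'a set" where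
  "lcs G 0 = carrier G"
| "lcs G (Suc i) = generate G {comm G x y | x y. x \<in> carrier G \<and> y \<in> lcs G i}"

definition nilpotent_class_le :: "('a, 'b) monoid_scheme \<Rightarrow> nat \<Rightarrow> bool" where
  "nilpotent_class_le G c \<longleftrightarrow> lcs G c = {\<one>\<^bsub>G\<^esub>}"

definition p_group :: "nat \<Rightarrow> ('a, 'b) monoid_scheme \<Rightarrow> bool" where
  "p_group p G \<longleftrightarrow> finite (carrier G) \<and> (\<exists>k. card (carrier G) = p ^ k)"

definition grp_exp :: "('a, 'b) monoid_scheme \<Rightarrow> nat" where
  "grp_exp G = (LEAST n. 0 < n \<and> (\<forall>x\<in>carrier G. x [^]\<^bsub>G\<^esub> n = \<one>\<^bsub>G\<^esub>))"

text \<open>Words in the letters (g,h,True) = g (x) h and (g,h,False) = (g (x) h)^{-1}.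
  The group G wedge G is the monoid of such words modulo the congruence generated by
  free cancellation, the defining relations of G (x) G, and x (x) x = 1.
  Multiplication is concatenation, the identity is the empty word.\<close>

type_synonym 'a tword = "('a \<times> 'a \<times> bool) list"

definition tword :: "('a, 'b) monoid_scheme \<Rightarrow> 'a tword \<Rightarrow> bool" where
  "tword G w \<longleftrightarrow> (\<forall>(g, h, b) \<in> set w. g \<in> carrier G \<and> h \<in> carrier G)"

inductive ext_eq :: "('a, 'b) monoid_scheme \<Rightarrow> 'a tword \<Rightarrow> 'a tword \<Rightarrow> bool"
  for G where
  refl: "ext_eq G u u"
| sym: "ext_eq G u v \<Longrightarrow> ext_eq G v u"
| trans: "ext_eq G u v \<Longrightarrow> ext_eq G v w \<Longrightarrow> ext_eq G u w"
| cong: "ext_eq G u v \<Longrightarrow> ext_eq G (a @ u @ c) (a @ v @ c)"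
| cancel: "g \<in> carrier G \<Longrightarrow> h \<in> carrier G \<Longrightarrow> ext_eq G [(g, h, b), (g, h, \<not> b)] []"
| rel_left: "g \<in> carrier G \<Longrightarrow> g' \<in> carrier G \<Longrightarrow> h \<in> carrier G \<Longrightarrow>
     ext_eq G [(g \<otimes>\<^bsub>G\<^esub> g', h, True)] [(conjg G g g', conjg G g h, True), (g, h, True)]"
| rel_right: "g \<in> carrier G \<Longrightarrow> h \<in> carrier G \<Longrightarrow> h' \<in> carrier G \<Longrightarrow>
     ext_eq G [(g, h \<otimes>\<^bsub>G\<^esub> h', True)] [(g, h, True), (conjg G h g, conjg G h h', True)]"
| diag: "x \<in> carrier G \<Longrightarrow> ext_eq G [(x, x, True)] []"

definition tw_pow :: "'a tword \<Rightarrow> nat \<Rightarrow> 'a tword" where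
  "tw_pow w n = concat (replicate n w)"

fun kappa :: "('a, 'b) monoid_scheme \<Rightarrow> 'a tword \<Rightarrow> 'a" where
  "kappa G [] = \<one>\<^bsub>G\<^esub>"
| "kappa G ((g, h, b) # w) =
     (if b then comm G g h else inv\<^bsub>G\<^esub> (comm G g h)) \<otimes>\<^bsub>G\<^esub> kappa G w"

end

theory Submission
  imports Defs
begin

text \<open>Let \<open>S\<close> be the semidirect product of \<open>G \<and> G\<close> with \<open>G\<close> and let \<open>n = p\<^sup>e\<close> be the exponent of
  \<open>G\<close>. The \<open>k\<close>-th term of the lower central series of \<open>S\<close> is generated by that of \<open>G\<close> and the
  \<open>x \<and> h\<close> with \<open>h\<close> in that of \<open>G\<close>, so \<open>S\<close> has class at most \<open>p - 1\<close> as well. Expanding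
  \<open>y\<^sup>n \<and> x = 1\<close> shows that \<open>y\<inverse> \<cdot> (y \<and> x)\<close> has order dividing \<open>n\<close>; hence \<open>S\<close> is generated
  by elements of order dividing \<open>n\<close>. Since its class is less than \<open>p\<close>, \<open>S\<close> has exponent dividing
  \<open>n\<close>, which follows from the identity \<open>(a b)\<^sup>n = a\<^sup>n b\<^sup>n\<close>, valid when \<open>\<gamma>\<^sub>2\<close> has exponent dividing
  \<open>n\<close>: in a filtered group the polynomial sequences form a group (Lazard, Leibman), and the
  sequence \<open>m \<mapsto> (a b)\<^sup>m b\<^sup>-\<^sup>m a\<^sup>-\<^sup>m\<close> vanishes at 0 and 1, so its Taylor coefficients lie in
  \<open>\<gamma>\<^sub>2\<close> while the binomial coefficients \<open>n choose d\<close> with \<open>2 \<le> d < p\<close> are multiples of \<open>n\<close>.\<close>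

section \<open>Commutators and the lower central series\<close>

context group
begin

lemma inv_cancel_left [simp]:
  assumes "x \<in> carrier G" "y \<in> carrier G"
  shows "x \<otimes> (inv x \<otimes> y) = y" "inv x \<otimes> (x \<otimes> y) = y"
  using assms by (simp_all add: m_assoc [symmetric])

lemma comm_closed [simp]:
  "\<lbrakk>x \<in> carrier G; y \<in> carrier G\<rbrakk> \<Longrightarrow> comm G x y \<in> carrier G"
  by (simp add: comm_def)

lemma conjg_closed [simp]:
  "\<lbrakk>x \<in> carrier G; y \<in> carrier G\<rbrakk> \<Longrightarrow> conjg G x y \<in> carrier G"
  by (simp add: conjg_def)

lemma conjg_mult:
  "\<lbrakk>g \<in> carrier G; x \<in> carrier G; y \<in> carrier G\<rbrakk>
    \<Longrightarrow> conjg G g (x \<otimes> y) = conjg G g x \<otimes> conjg G g y"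
  by (simp add: conjg_def m_assoc)

lemma conjg_inv:
  "\<lbrakk>g \<in> carrier G; x \<in> carrier G\<rbrakk> \<Longrightarrow> conjg G g (inv x) = inv (conjg G g x)"
  by (simp add: conjg_def m_assoc inv_mult_group)

lemma conjg_conjg:
  "\<lbrakk>g \<in> carrier G; h \<in> carrier G; x \<in> carrier G\<rbrakk>
    \<Longrightarrow> conjg G g (conjg G h x) = conjg G (g \<otimes> h) x"
  by (simp add: conjg_def m_assoc inv_mult_group)

lemma conjg_one [simp]:
  "g \<in> carrier G \<Longrightarrow> conjg G g \<one> = \<one>" "x \<in> carrier G \<Longrightarrow> conjg G \<one> x = x"
  by (simp_all add: conjg_def)

lemma conjg_pow:
  "\<lbrakk>g \<in> carrier G; x \<in> carrier G\<rbrakk> \<Longrightarrow> conjg G g (x [^] (n::nat)) = conjg G g x [^] n"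
  by (induction n) (simp_all add: conjg_mult)

lemma inv_comm:
  "\<lbrakk>x \<in> carrier G; y \<in> carrier G\<rbrakk> \<Longrightarrow> inv (comm G x y) = comm G y x"
  by (simp add: comm_def inv_mult_group m_assoc)

lemma comm_mult_left:
  "\<lbrakk>x \<in> carrier G; y \<in> carrier G; z \<in> carrier G\<rbrakk>
    \<Longrightarrow> comm G (x \<otimes> y) z = conjg G x (comm G y z) \<otimes> comm G x z"
  by (simp add: comm_def conjg_def inv_mult_group m_assoc)

lemma comm_inv_left:
  "\<lbrakk>x \<in> carrier G; z \<in> carrier G\<rbrakk>
    \<Longrightarrow> comm G (inv x) z = conjg G (inv x) (inv (comm G x z))"
  by (simp add: comm_def conjg_def inv_mult_group m_assoc)

text \<open>Written out, the three commutators cancel already in the free group on \<open>x\<close>,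
  \<open>y\<close>, \<open>z\<close>. If two of the factors lie in a subgroup, so does the third,
  which is how commutators of two \<open>lcs\<close> terms get located.\<close>

lemma hall_witt:
  assumes "x \<in> carrier G" "y \<in> carrier G" "z \<in> carrier G"
  shows "comm G (comm G x y) (conjg G y z) \<otimes> comm G (comm G y z) (conjg G z x)
    \<otimes> comm G (comm G z x) (conjg G x y) = \<one>"
  using assms by (simp add: comm_def conjg_def inv_mult_group m_assoc)

section \<open>Normal subgroups and generating sets\<close>

lemma normal_conjg:
  "\<lbrakk>N \<lhd> G; g \<in> carrier G; x \<in> N\<rbrakk> \<Longrightarrow> conjg G g x \<in> N"
  by (simp add: conjg_def normal.inv_op_closed2)

lemma normalI_conjg:
  assumes "subgroup N G" "\<And>g x. \<lbrakk>g \<in> carrier G; x \<in> N\<rbrakk> \<Longrightarrow> conjg G g x \<in> N"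
  shows "N \<lhd> G"
  using assms unfolding conjg_def by (simp add: normal_inv_iff)

text \<open>For fixed \<open>y\<close>, the elements \<open>x\<close> with \<open>comm G x y\<close>
  in \<open>N\<close> form a subgroup: \<open>comm_mult_left\<close> and
  \<open>comm_inv_left\<close> introduce only conjugations, which a normal \<open>N\<close>
  absorbs.\<close>

lemma comm_generate_left:
  assumes N: "N \<lhd> G" and A: "A \<subseteq> carrier G" and y: "y \<in> carrier G"
    and AB: "\<And>x. x \<in> A \<Longrightarrow> comm G x y \<in> N" and x: "x \<in> generate G A"
  shows "comm G x y \<in> N"
  using x
proof (induction rule: generate.induct)
  case one
  have "\<one> \<in> N" using N by (simp add: normal_imp_subgroup subgroup.one_closed)
  then show ?case using y by (simp add: comm_def)
next
  case (incl h)
  then show ?case by (rule AB)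
next
  case (inv h)
  then show ?case
    using A y AB [of h] normal_conjg [OF N]
      subgroup.m_inv_closed [OF normal_imp_subgroup [OF N]]
    by (simp add: comm_inv_left subset_iff)
next
  case (eng h1 h2)
  then have "h1 \<in> carrier G" "h2 \<in> carrier G"
    using generate_in_carrier [OF A] by auto
  then show ?case using eng y N
    by (auto simp: comm_mult_left
        intro!: normal_conjg subgroup.m_closed normal_imp_subgroup)
qed

lemma comm_generate:
  assumes N: "N \<lhd> G" and A: "A \<subseteq> carrier G" and B: "B \<subseteq> carrier G"
    and AB: "\<And>x y. \<lbrakk>x \<in> A; y \<in> B\<rbrakk> \<Longrightarrow> comm G x y \<in> N"
    and x: "x \<in> generate G A" and y: "y \<in> generate G B"
  shows "comm G x y \<in> N"
proof -
  have xc: "x \<in> carrier G" and yc: "y \<in> carrier G"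
    using x y A B generate_in_carrier by auto
  have "comm G x t \<in> N" if "t \<in> B" for t
    using comm_generate_left [OF N A _ AB x] that B by blast
  then have "comm G t x \<in> N" if "t \<in> B" for t
    using that B xc inv_comm [of x t] subgroup.m_inv_closed [OF normal_imp_subgroup [OF N]]
    by (metis subsetD)
  then have "comm G y x \<in> N"
    using comm_generate_left [OF N B xc _ y] by blast
  then show ?thesis
    using inv_comm [OF yc xc] subgroup.m_inv_closed [OF normal_imp_subgroup [OF N]] by metis
qed

lemma conjg_generate:
  assumes A: "A \<subseteq> carrier G" and g: "g \<in> carrier G"
    and gA: "\<And>x. x \<in> A \<Longrightarrow> conjg G g x \<in> generate G B" and B: "B \<subseteq> carrier G"
    and x: "x \<in> generate G A"
  shows "conjg G g x \<in> generate G B"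
  using x
proof (induction rule: generate.induct)
  case one
  then show ?case using g by (simp add: generate.one)
next
  case (incl h)
  then show ?case by (rule gA)
next
  case (inv h)
  then show ?case using A g gA [of h] subgroup.m_inv_closed [OF generate_is_subgroup [OF B]]
    by (auto simp: conjg_inv subset_iff)
next
  case (eng h1 h2)
  then show ?case using A g generate_in_carrier [OF A]
    by (simp add: conjg_mult generate.eng)
qed

text \<open>Conjugation by a generator need only map \<open>B\<close> into \<open>\<langle>B\<rangle>\<close> when the generating set of
  the group is closed under inversion.\<close>
lemma normal_generate:
  assumes A: "A \<subseteq> carrier G" and gen: "generate G A = carrier G"
    and Ainv: "\<And>x. x \<in> A \<Longrightarrow> inv x \<in> A"
    and B: "B \<subseteq> carrier G"
    and AB: "\<And>x y. \<lbrakk>x \<in> A; y \<in> B\<rbrakk> \<Longrightarrow> conjg G x y \<in> generate G B"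
  shows "generate G B \<lhd> G"
proof (rule normalI_conjg)
  show "subgroup (generate G B) G" using B by (rule generate_is_subgroup)
  have AB': "conjg G x y \<in> generate G B" if "x \<in> A" "y \<in> generate G B" for x y
    using conjg_generate [OF B _ AB B] that A by blast
  fix g y assume g: "g \<in> carrier G" and y: "y \<in> generate G B"
  have "g \<in> generate G A" using g gen by simp
  then show "conjg G g y \<in> generate G B"
    using y
  proof (induction arbitrary: y rule: generate.induct)
    case one
    then show ?case using generate_in_carrier [OF B] by simp
  next
    case (incl h)
    then show ?case by (rule AB')
  next
    case (inv h)
    then show ?case using AB' Ainv by blast
  next
    case (eng h1 h2)
    have "conjg G (h1 \<otimes> h2) y = conjg G h1 (conjg G h2 y)"
      using eng.hyps eng.prems A B generate_in_carrier by (simp add: conjg_conjg)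
    then show ?case using eng by simp
  qed
qed

section \<open>The lower central series\<close>

lemma lcs_normal: "lcs G i \<lhd> G"
proof (induction i)
  case 0
  show ?case using normal_inv_iff subgroup_self by auto
next
  case (Suc i)
  let ?S = "{comm G x y | x y. x \<in> carrier G \<and> y \<in> lcs G i}"
  have sub: "lcs G i \<subseteq> carrier G"
    by (rule subgroup.subset [OF normal_imp_subgroup [OF Suc]])
  have S: "?S \<subseteq> carrier G" using sub by auto
  \<comment> \<open>Conjugation is an automorphism, so it carries a commutator to the commutator of
    the conjugated entries.\<close>
  have S_conjg: "conjg G g s \<in> ?S" if "g \<in> carrier G" "s \<in> ?S" for g s
  proof -
    from that obtain x y where *: "x \<in> carrier G" "y \<in> lcs G i" "s = comm G x y" by blast
    then have "conjg G g s = comm G (conjg G g x) (conjg G g y)"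
      using that subsetD [OF sub] by (simp add: comm_def conjg_inv conjg_mult)
    moreover have "conjg G g x \<in> carrier G" "conjg G g y \<in> lcs G i"
      using * that normal_conjg [OF Suc] by simp_all
    ultimately show ?thesis by blast
  qed
  have "conjg G g s \<in> generate G ?S" if "g \<in> carrier G" "s \<in> generate G ?S" for g s
    by (rule conjg_generate [OF S that(1) generate.incl [OF S_conjg [OF that(1)]] S that(2)])
  then have "generate G ?S \<lhd> G"
    using S by (intro normalI_conjg generate_is_subgroup)
  then show ?case by simp
qed

lemma lcs_subgroup: "subgroup (lcs G i) G"
  by (rule normal_imp_subgroup [OF lcs_normal])

lemma lcs_in_carrier: "x \<in> lcs G i \<Longrightarrow> x \<in> carrier G"
  by (rule subgroup.mem_carrier [OF lcs_subgroup])

lemma comm_lcs_carrier: "\<lbrakk>x \<in> carrier G; y \<in> lcs G i\<rbrakk> \<Longrightarrow> comm G x y \<in> lcs G (Suc i)"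
  by (auto intro!: generate.incl)

lemma comm_lcs_carrier':
  assumes "x \<in> lcs G i" "y \<in> carrier G" shows "comm G x y \<in> lcs G (Suc i)"
  using subgroup.m_inv_closed [OF lcs_subgroup comm_lcs_carrier [OF assms(2,1)]]
  by (simp add: inv_comm [OF assms(2) lcs_in_carrier [OF assms(1)]] del: lcs.simps)

lemma lcs_Suc_subset: "lcs G (Suc i) \<subseteq> lcs G i"
proof -
  have "comm G x y \<in> lcs G i" if "x \<in> carrier G" "y \<in> lcs G i" for x y
  proof -
    have "comm G x y = conjg G x y \<otimes> inv y"
      using that lcs_in_carrier by (simp add: comm_def conjg_def)
    then show ?thesis
      using that normal_conjg [OF lcs_normal] subgroup.m_inv_closed [OF lcs_subgroup]
        subgroup.m_closed [OF lcs_subgroup] by simp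
  qed
  then have "{comm G x y | x y. x \<in> carrier G \<and> y \<in> lcs G i} \<subseteq> lcs G i" by blast
  from generate_subgroup_incl [OF this lcs_subgroup] show ?thesis by simp
qed

lemma lcs_antimono: "i \<le> j \<Longrightarrow> lcs G j \<subseteq> lcs G i"
  by (rule lift_Suc_antimono_le) (use lcs_Suc_subset in auto)

text \<open>Since \<open>lcs G i\<close> is the term \<open>\<gamma>\<^sub>i\<^sub>+\<^sub>1\<close>, the indices are off by one
  from the familiar \<open>[\<gamma>\<^sub>i, \<gamma>\<^sub>j] \<subseteq> \<gamma>\<^sub>i\<^sub>+\<^sub>j\<close>.\<close>
lemma comm_lcs_lcs: "\<lbrakk>x \<in> lcs G i; y \<in> lcs G j\<rbrakk> \<Longrightarrow> comm G x y \<in> lcs G (Suc (i + j))"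
proof (induction i arbitrary: j x y)
  case 0
  then show ?case using comm_lcs_carrier by simp
next
  case (Suc i)
  let ?N = "lcs G (Suc (Suc i + j))"
  let ?S = "{comm G x y | x y. x \<in> carrier G \<and> y \<in> lcs G i}"
  have N: "?N \<lhd> G" by (rule lcs_normal)
  have S: "?S \<subseteq> carrier G" using lcs_in_carrier by auto
  have y: "y \<in> carrier G" using Suc.prems lcs_in_carrier by blast
  have inN: "inv s \<in> ?N" if "s \<in> ?N" for s
    by (rule subgroup.m_inv_closed [OF lcs_subgroup that])
  have "comm G s y \<in> ?N" if "s \<in> ?S" for s
  proof -
    from that obtain u v where uv: "u \<in> carrier G" "v \<in> lcs G i" "s = comm G u v" by blast
    have v: "v \<in> carrier G" using uv lcs_in_carrier by blast
    \<comment> \<open>With this \<open>z\<close>, the commutator of \<open>s\<close> and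
      \<open>y\<close> is the first factor of the Hall-Witt identity for \<open>u\<close>,
      \<open>v\<close>, \<open>z\<close>.\<close>
    define z where "z = conjg G (inv v) y"
    have z: "z \<in> lcs G j" "z \<in> carrier G"
      unfolding z_def using normal_conjg [OF lcs_normal _ Suc.prems(2)] v y by simp_all
    have y_eq: "y = conjg G v z" using y v by (simp add: z_def conjg_conjg)
    have 1: "comm G (comm G v z) (conjg G z u) \<in> ?N"
      using comm_lcs_carrier' [OF Suc.IH [OF uv(2) z(1)] conjg_closed [OF z(2) uv(1)]]
      by (simp del: lcs.simps)
    \<comment> \<open>The induction hypothesis is used here at \<open>Suc j\<close>, because
      \<open>comm G z u\<close> lies in \<open>lcs G (Suc j)\<close>.\<close>
    have "comm G (conjg G u v) (comm G z u) \<in> ?N"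
      using Suc.IH [OF normal_conjg [OF lcs_normal uv(1,2)] comm_lcs_carrier' [OF z(1) uv(1)]]
      by (simp del: lcs.simps)
    then have 2: "comm G (comm G z u) (conjg G u v) \<in> ?N"
      using inN inv_comm [of "conjg G u v" "comm G z u"] z(2) uv(1) v
      by (metis comm_closed conjg_closed)
    let ?a = "comm G s y" and ?b = "comm G (comm G v z) (conjg G z u)"
      and ?c = "comm G (comm G z u) (conjg G u v)"
    have cl: "?a \<in> carrier G" "?b \<in> carrier G" "?c \<in> carrier G" "s \<in> carrier G"
      using uv v z y by auto
    have "?a \<otimes> (?b \<otimes> ?c) = \<one>"
      using hall_witt [OF uv(1) v z(2)] cl uv y_eq by (simp add: m_assoc)
    then have "?a = inv (?b \<otimes> ?c)" using cl inv_equality [of ?a "?b \<otimes> ?c"] by simp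
    moreover have "inv (?b \<otimes> ?c) \<in> ?N"
      by (intro inN subgroup.m_closed [OF lcs_subgroup] 1 2)
    ultimately show ?thesis by simp
  qed
  then show ?case
    using comm_generate_left [OF N S y, of x] Suc.prems(1) by (simp only: lcs.simps)
qed

end

section \<open>Polynomial sequences in a filtered group\<close>

text \<open>\<open>F_comm\<close> with \<open>i = 0\<close> makes \<open>F 0\<close> normalise every
  \<open>F j\<close>. \<open>F 0\<close> may be a proper subgroup and may coincide with
  \<open>F 1\<close>; both occur in the application.\<close>

locale filtered_group = group G for G (structure) +
  fixes F :: "nat \<Rightarrow> 'a set" and c :: nat
  assumes F_subgroup: "subgroup (F i) G"
    and F_Suc: "F (Suc i) \<subseteq> F i"
    and F_comm: "\<lbrakk>x \<in> F i; y \<in> F j\<rbrakk> \<Longrightarrow> comm G x y \<in> F (i + j)"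
    and F_trivial: "F c = {\<one>}"
begin

text \<open>Both the left and the right difference are required to be polynomial, which makes
  closure under pointwise inversion immediate.\<close>
inductive pseq :: "nat \<Rightarrow> (nat \<Rightarrow> 'a) \<Rightarrow> bool" where
  trivial: "pseq k (\<lambda>_. \<one>)"
| step: "\<lbrakk>\<And>m. f m \<in> F k; pseq (Suc k) (\<lambda>m. inv f m \<otimes> f (Suc m));
    pseq (Suc k) (\<lambda>m. f (Suc m) \<otimes> inv f m)\<rbrakk> \<Longrightarrow> pseq k f"

lemma F_closed [simp]: "x \<in> F k \<Longrightarrow> x \<in> carrier G"
  by (rule subgroup.mem_carrier [OF F_subgroup])

lemma F_antimono: "i \<le> j \<Longrightarrow> F j \<subseteq> F i"
  by (rule lift_Suc_antimono_le) (use F_Suc in auto)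

lemma F_trivial': "\<lbrakk>c \<le> k; x \<in> F k\<rbrakk> \<Longrightarrow> x = \<one>"
  using F_antimono F_trivial by blast

lemma pseq_in_F: "pseq k f \<Longrightarrow> f m \<in> F k"
  by (erule pseq.cases) (auto simp: F_subgroup subgroup.one_closed)

lemma pseq_closed [simp]: "pseq k f \<Longrightarrow> f m \<in> carrier G"
  by (rule F_closed [OF pseq_in_F])

lemma pseq_left: "pseq k f \<Longrightarrow> pseq (Suc k) (\<lambda>m. inv f m \<otimes> f (Suc m))"
  by (erule pseq.cases) (auto intro: pseq.trivial)

lemma pseq_right: "pseq k f \<Longrightarrow> pseq (Suc k) (\<lambda>m. f (Suc m) \<otimes> inv f m)"
  by (erule pseq.cases) (auto intro: pseq.trivial)

lemma pseq_trivial: "\<lbrakk>c \<le> k; pseq k f\<rbrakk> \<Longrightarrow> f = (\<lambda>_. \<one>)"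
  using pseq_in_F F_trivial' by blast

lemma pseq_SucD: "pseq (Suc k) f \<Longrightarrow> pseq k f"
proof (induction "Suc k" f arbitrary: k rule: pseq.induct)
  case trivial
  show ?case by (rule pseq.trivial)
next
  case (step f)
  show ?case
    by (rule pseq.step) (rule subsetD [OF F_Suc step.hyps(1)] step.hyps(3,5))+
qed

lemma pseq_0: "pseq k f \<Longrightarrow> pseq 0 f"
  by (induction k) (auto dest: pseq_SucD)

lemma pseq_inv: "pseq k f \<Longrightarrow> pseq k (\<lambda>m. inv f m)"
proof (induction rule: pseq.induct)
  case (trivial k)
  show ?case using pseq.trivial by simp
next
  case (step f k)
  have [simp]: "f m \<in> carrier G" for m by (rule F_closed [OF step.hyps(1)])
  show ?case
  proof (rule pseq.step)
    show "inv f m \<in> F k" for m by (rule subgroup.m_inv_closed [OF F_subgroup step.hyps(1)])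
    show "pseq (Suc k) (\<lambda>m. inv (inv f m) \<otimes> inv f (Suc m))"
      using step.IH(2) by (simp add: inv_mult_group)
    show "pseq (Suc k) (\<lambda>m. inv f (Suc m) \<otimes> inv (inv f m))"
      using step.IH(1) by (simp add: inv_mult_group)
  qed
qed

lemma pseq_shift: "pseq k f \<Longrightarrow> pseq k (\<lambda>m. f (Suc m))"
proof (induction rule: pseq.induct)
  case (trivial k)
  show ?case by (rule pseq.trivial)
next
  case (step f k)
  show ?case by (rule pseq.step) (rule step.hyps(1) step.IH)+
qed

text \<open>The three closures feed each other, so they are proved together by downward induction
  from level \<open>c\<close>, where all sequences are trivial. Differences at level
  \<open>k\<close> are products, conjugates and commutators of sequences for which the closures at
  level \<open>Suc k\<close> are available.\<close>

lemma pseq_closures: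
  assumes "k \<le> c"
  shows "(\<forall>f g. pseq k f \<and> pseq k g \<longrightarrow> pseq k (\<lambda>m. f m \<otimes> g m))
    \<and> (\<forall>f g. pseq 0 g \<and> pseq k f \<longrightarrow> pseq k (\<lambda>m. conjg G (g m) (f m)))
    \<and> (\<forall>i j f g. i + j = k \<and> pseq i f \<and> pseq j g \<longrightarrow> pseq k (\<lambda>m. comm G (f m) (g m)))"
  using assms
proof (induction k rule: inc_induct)
  case base
  have "comm G (f m) (g m) = \<one>" if "i + j = c" "pseq i f" "pseq j g" for i j f g m
    using F_comm [OF pseq_in_F [OF that(2)] pseq_in_F [OF that(3)], of m m] that(1) F_trivial
    by simp
  then show ?case
    by (auto dest!: pseq_trivial [OF order_refl] intro: pseq.trivial)
next
  case (step k)
  have mult': "pseq (Suc k) (\<lambda>m. f m \<otimes> g m)"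
    if "pseq (Suc k) f" "pseq (Suc k) g" for f g using step.IH that by blast
  have conj': "pseq (Suc k) (\<lambda>m. conjg G (g m) (f m))"
    if "pseq 0 g" "pseq (Suc k) f" for f g using step.IH that by blast
  have comm': "pseq (Suc k) (\<lambda>m. comm G (f m) (g m))"
    if "i + j = Suc k" "pseq i f" "pseq j g" for i j f g using step.IH that by blast
  have mult: "pseq k (\<lambda>m. f m \<otimes> g m)" if f: "pseq k f" and g: "pseq k g" for f g
  proof (rule pseq.step)
    have [simp]: "f m \<in> carrier G" "g m \<in> carrier G" for m using f g by simp_all
    show "f m \<otimes> g m \<in> F k" for m
      by (rule subgroup.m_closed [OF F_subgroup pseq_in_F [OF f] pseq_in_F [OF g]])
    \<comment> \<open>The left difference of a product: that of \<open>f\<close>, conjugated past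
      \<open>g m\<close>, times that of \<open>g\<close>.\<close>
    have "pseq (Suc k) (\<lambda>m. conjg G (inv g m) (inv f m \<otimes> f (Suc m)) \<otimes> (inv g m \<otimes> g (Suc m)))"
      by (rule mult' [OF conj' [OF pseq_inv [OF pseq_0 [OF g]] pseq_left [OF f]] pseq_left [OF g]])
    then show "pseq (Suc k) (\<lambda>m. inv (f m \<otimes> g m) \<otimes> (f (Suc m) \<otimes> g (Suc m)))"
      by (simp add: conjg_def m_assoc inv_mult_group)
    have "pseq (Suc k) (\<lambda>m. (f (Suc m) \<otimes> inv f m) \<otimes> conjg G (f m) (g (Suc m) \<otimes> inv g m))"
      by (rule mult' [OF pseq_right [OF f] conj' [OF pseq_0 [OF f] pseq_right [OF g]]])
    then show "pseq (Suc k) (\<lambda>m. f (Suc m) \<otimes> g (Suc m) \<otimes> inv (f m \<otimes> g m))"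
      by (simp add: conjg_def m_assoc inv_mult_group)
  qed
  have comm: "pseq k (\<lambda>m. comm G (f m) (g m))"
    if k: "i + j = k" and f: "pseq i f" and g: "pseq j g" for i j f g
  proof (rule pseq.step)
    have [simp]: "f m \<in> carrier G" "g m \<in> carrier G" for m using f g by simp_all
    have 0: "pseq 0 f" "pseq 0 g" "pseq 0 (\<lambda>m. inv f m)" "pseq 0 (\<lambda>m. inv g m)"
      by (rule pseq_0 [OF f] pseq_0 [OF g] pseq_inv [OF pseq_0 [OF f]] pseq_inv [OF pseq_0 [OF g]])+
    show "comm G (f m) (g m) \<in> F k" for m
      using F_comm [OF pseq_in_F [OF f] pseq_in_F [OF g]] k by simp
    define u where "u = (\<lambda>m. comm G (inv f m \<otimes> f (Suc m)) (g (Suc m)))"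
    define v where "v = (\<lambda>m. comm G (f m) (inv g m \<otimes> g (Suc m)))"
    have u: "pseq (Suc k) u" unfolding u_def
      using k by (intro comm' [OF _ pseq_left [OF f] pseq_shift [OF g]]) simp
    have v: "pseq (Suc k) v" unfolding v_def
      using k by (intro comm' [OF _ f pseq_left [OF g]]) simp
    have [simp]: "u m \<in> carrier G" "v m \<in> carrier G" for m using u v by simp_all
    \<comment> \<open>Write \<open>f (Suc m)\<close> as \<open>f m\<close> times its left
      difference, likewise for \<open>g\<close>, and expand the commutator first in the left and
      then in the right entry.\<close>
    have key: "comm G (f (Suc m)) (g (Suc m))
      = conjg G (f m) (u m) \<otimes> comm G (f m) (g m) \<otimes> conjg G (g m) (v m)" for m
      by (simp add: u_def v_def comm_def conjg_def m_assoc inv_mult_group)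
    \<comment> \<open>The outer four conjugations amount to conjugating by the inverse of
      \<open>comm G (f m) (g m)\<close>. They are done one letter at a time because
      \<open>conj'\<close> needs level 0 sequences, and closure of level 0 under products is not yet
      available.\<close>
    have "pseq (Suc k) (\<lambda>m. conjg G (g m) (conjg G (f m) (conjg G (inv g m) (conjg G (inv f m)
      (conjg G (f m) (u m))))) \<otimes> conjg G (g m) (v m))"
      by (rule mult' conj' u v 0)+
    then show "pseq (Suc k) (\<lambda>m. inv (comm G (f m) (g m)) \<otimes> comm G (f (Suc m)) (g (Suc m)))"
      unfolding key by (simp add: comm_def conjg_def m_assoc inv_mult_group)
    have "pseq (Suc k) (\<lambda>m. conjg G (f m) (u m) \<otimes> conjg G (f m) (conjg G (g m)
      (conjg G (inv f m) (conjg G (inv g m) (conjg G (g m) (v m))))))"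
      by (rule mult' conj' u v 0)+
    then show "pseq (Suc k) (\<lambda>m. comm G (f (Suc m)) (g (Suc m)) \<otimes> inv (comm G (f m) (g m)))"
      unfolding key by (simp add: comm_def conjg_def m_assoc inv_mult_group)
  qed
  have "pseq k (\<lambda>m. conjg G (g m) (f m))" if g: "pseq 0 g" and f: "pseq k f" for f g
  proof -
    \<comment> \<open>A conjugate is a commutator times the original element, and the commutator has
      level \<open>0 + k\<close>.\<close>
    have "pseq k (\<lambda>m. comm G (g m) (f m) \<otimes> f m)"
      using comm [of 0 k] mult f g by auto
    then show ?thesis using f g by (simp add: comm_def conjg_def m_assoc)
  qed
  with mult comm show ?case by blast
qed

section \<open>Taylor expansion with binomial exponents\<close>

lemma pseq_mult: "\<lbrakk>pseq 0 f; pseq 0 g\<rbrakk> \<Longrightarrow> pseq 0 (\<lambda>m. f m \<otimes> g m)"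
  using pseq_closures [of 0] by simp

text \<open>By Pascal's rule both differences of the sequence for \<open>Suc j\<close> are the
  sequence for \<open>j\<close>, while the level rises from \<open>i\<close> to
  \<open>Suc i\<close>; the sum of the two indices is preserved.\<close>

lemma pseq_binomial: "g \<in> F (i + j) \<Longrightarrow> pseq i (\<lambda>m. g [^] (m choose j))"
proof (induction j arbitrary: i)
  case 0
  then show ?case by (intro pseq.step [of _ i]) (simp_all add: pseq.trivial)
next
  case (Suc j)
  have g: "g \<in> carrier G" using Suc.prems by (rule F_closed)
  have "g \<in> F i" using Suc.prems F_antimono [of i "i + Suc j"] by auto
  then have F: "g [^] n \<in> F i" for n :: nat
    by (induction n)
      (simp_all add: subgroup.one_closed [OF F_subgroup] subgroup.m_closed [OF F_subgroup])
  have "pseq (Suc i) (\<lambda>m. g [^] (m choose j))" using Suc by simp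
  moreover have "inv (g [^] (m choose Suc j)) \<otimes> g [^] (Suc m choose Suc j) = g [^] (m choose j)"
    for m using g by (simp add: add.commute [of "m choose j"] flip: nat_pow_mult)
  moreover have "g [^] (Suc m choose Suc j) \<otimes> inv (g [^] (m choose Suc j)) = g [^] (m choose j)"
    for m using g by (simp add: m_assoc flip: nat_pow_mult)
  ultimately show ?case using F by (intro pseq.step [of _ i]) simp_all
qed

text \<open>If \<open>f\<close> vanishes below \<open>Suc d\<close>, its left difference vanishes
  below \<open>d\<close> and equals \<open>f (Suc d)\<close> at \<open>d\<close>. Each such
  difference gains one level.\<close>

lemma pseq_vanishing: "\<lbrakk>pseq k f; \<And>m. m < d \<Longrightarrow> f m = \<one>\<rbrakk> \<Longrightarrow> f d \<in> F (k + d)"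
proof (induction d arbitrary: k f)
  case 0
  then show ?case using pseq_in_F by simp
next
  case (Suc d)
  have "inv f d \<otimes> f (Suc d) \<in> F (Suc k + d)"
    using Suc.prems by (intro Suc.IH pseq_left) auto
  then show ?case using Suc.prems by simp
qed

text \<open>The factors \<open>g\<^sub>d ^ (m choose d)\<close> of the Taylor expansion of \<open>f\<close> at \<open>m = 0\<close> are split off
  one after the other.\<close>
lemma pseq_eq_one:
  assumes "pseq 0 f" "\<And>m. m < d \<Longrightarrow> f m = \<one>" "2 \<le> d"
    and dvd: "\<And>d. \<lbrakk>2 \<le> d; d < c\<rbrakk> \<Longrightarrow> n dvd n choose d"
    and F2: "\<And>x. x \<in> F 2 \<Longrightarrow> x [^] n = \<one>"
  shows "f n = \<one>"
  using assms(1-3)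
proof (induction "c - d" arbitrary: d f)
  case 0
  have "f m = \<one>" for m
  \<comment> \<open>Here \<open>c \<le> d\<close>. Once all values before some
    \<open>m \<ge> d\<close> are trivial, \<open>f m\<close> lies in \<open>F m\<close>, which is
    trivial.\<close>
  proof (induction m rule: less_induct)
    case (less m)
    show ?case
    proof (cases "m < d")
      case False
      then show ?thesis
        using pseq_vanishing [OF \<open>pseq 0 f\<close> less.IH] 0 F_trivial' [of m] by simp
    qed (use 0 in simp)
  qed
  then show ?case .
next
  case (Suc k)
  define g where "g = f d"
  have gF: "g \<in> F d" unfolding g_def using pseq_vanishing [of 0 f d] Suc.prems by simp
  then have g: "g \<in> carrier G" and g2: "g \<in> F 2"
    using F_antimono [of 2 d] Suc.prems by auto
  \<comment> \<open>Values below \<open>d\<close> are unchanged, as \<open>m choose d\<close> is 0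
    there, and the value at \<open>d\<close> is cancelled, as \<open>d choose d\<close> is
    1.\<close>
  define h where "h = (\<lambda>m. inv (g [^] (m choose d)) \<otimes> f m)"
  have h: "pseq 0 h" unfolding h_def
    using gF Suc.prems by (intro pseq_mult [OF pseq_inv [OF pseq_binomial]]) simp_all
  have h1: "h m = \<one>" if "m < Suc d" for m
    using that Suc.prems g by (cases "m = d") (simp_all add: h_def g_def binomial_eq_0)
  have "h n = \<one>"
    using Suc.hyps(2) Suc.prems(3) by (intro Suc.hyps(1) [of "Suc d", OF _ h h1]) simp_all
  then have "f n = g [^] (n choose d)"
    using g Suc.prems(1) inv_cancel_left(1) [of "g [^] (n choose d)" "f n"] by (simp add: h_def)
  moreover have "d < c" using Suc.hyps(2) by linarith
  then obtain q where "n choose d = n * q"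
    using dvd [OF Suc.prems(3)] by (metis dvdE)
  ultimately show ?case using F2 [OF g2] g by (simp flip: nat_pow_pow)
qed

lemma pow_mult_filtered:
  assumes "a \<in> F 1" "b \<in> F 1"
    and "\<And>d. \<lbrakk>2 \<le> d; d < c\<rbrakk> \<Longrightarrow> n dvd n choose d"
    and "\<And>x. x \<in> F 2 \<Longrightarrow> x [^] n = \<one>"
  shows "(a \<otimes> b) [^] n = a [^] n \<otimes> b [^] n"
proof -
  have [simp]: "a \<in> carrier G" "b \<in> carrier G" using assms by auto
  have P: "pseq 0 (\<lambda>m. x [^] m)" if "x \<in> F 1" for x
    using pseq_binomial [of x 0 1] that by simp
  have ab: "a \<otimes> b \<in> F 1" using assms(1,2) by (rule subgroup.m_closed [OF F_subgroup])
  define f where "f = (\<lambda>m::nat. (a \<otimes> b) [^] m \<otimes> (inv (b [^] m) \<otimes> inv (a [^] m)))"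
  have "pseq 0 f" unfolding f_def
    using assms ab by (intro pseq_mult pseq_inv P)
  moreover have "f m = \<one>" if "m < 2" for m
    using that by (auto simp: f_def m_assoc less_2_cases_iff)
  ultimately have "f n = \<one>" using assms by (intro pseq_eq_one [of f 2 n]) auto
  then have "(a \<otimes> b) [^] n \<otimes> inv (a [^] n \<otimes> b [^] n) = \<one>"
    by (simp add: f_def inv_mult_group)
  then show ?thesis
    using inv_equality [of "(a \<otimes> b) [^] n" "inv (a [^] n \<otimes> b [^] n)"] by simp
qed

end

section \<open>Groups of class less than p generated by elements of bounded order\<close>

text \<open>In \<open>d * (p ^ e choose d) = p ^ e * (p ^ e - 1 choose (d - 1))\<close> the factor
  \<open>d\<close> is coprime to \<open>p\<close>.\<close>

lemma prime_power_dvd_choose: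
  fixes p :: nat
  assumes "Factorial_Ring.prime p" "0 < d" "d < p"
  shows "p ^ e dvd p ^ e choose d"
proof -
  have "\<not> p dvd d" using assms by (simp add: nat_dvd_not_less)
  then have "coprime p d" using assms(1) by (simp add: prime_imp_coprime)
  then have "coprime (p ^ e) d" by simp
  moreover have "d * (p ^ e choose d) = p ^ e * (p ^ e - 1 choose (d - 1))"
    using assms(2) by (rule times_binomial_minus1_eq)
  ultimately show ?thesis
    using coprime_dvd_mult_right_iff [of "p ^ e" d "p ^ e choose d"] by simp
qed

context group
begin

text \<open>A single \<open>x\<close> commutes with itself, so adjoining it to
  \<open>lcs G r\<close> still leaves all commutators in \<open>lcs G (Suc r)\<close>, where the
  exponent is known. The extra \<open>x\<close> allows a commutator with \<open>x\<close> to be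
  treated as a product of two elements of this subgroup.\<close>

lemma pow_mult_lcs:
  fixes p :: nat
  assumes p: "Factorial_Ring.prime p" and nil: "lcs G (p - 1) = {\<one>}"
    and exp: "\<And>y. y \<in> lcs G (Suc r) \<Longrightarrow> y [^] (p ^ e) = \<one>"
    and x: "x \<in> carrier G"
    and a: "a \<in> generate G (insert x (lcs G r))" and b: "b \<in> generate G (insert x (lcs G r))"
  shows "(a \<otimes> b) [^] (p ^ e) = a [^] (p ^ e) \<otimes> b [^] (p ^ e)"
proof -
  let ?A = "insert x (lcs G r)"
  let ?M = "generate G ?A"
  \<comment> \<open>The shift is chosen so that \<open>F 2\<close> is \<open>lcs G (Suc r)\<close>;
    \<open>F p\<close> is then contained in the trivial \<open>lcs G (p - 1)\<close>.\<close>
  define F where "F = (\<lambda>i. if i \<le> 1 then ?M else lcs G (r + i - 1))"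
  have p2: "2 \<le> p" using p by (rule prime_ge_2_nat)
  have A: "?A \<subseteq> carrier G" using x lcs_in_carrier by blast
  have lcsM: "lcs G r \<subseteq> ?M" by (auto intro: generate.incl)
  have Mc: "y \<in> carrier G" if "y \<in> ?M" for y using that generate_in_carrier [OF A] by blast
  have MM: "comm G u v \<in> lcs G (Suc r)" if "u \<in> ?M" "v \<in> ?M" for u v
  proof (rule comm_generate [OF lcs_normal A A _ that])
    fix s t assume "s \<in> ?A" "t \<in> ?A"
    then consider "s = x" "t = x" | "s \<in> carrier G" "t \<in> lcs G r" | "s \<in> lcs G r" "t \<in> carrier G"
      using x lcs_in_carrier by blast
    then show "comm G s t \<in> lcs G (Suc r)"
    proof cases
      case 1
      then have "comm G s t = \<one>" using x by (simp add: comm_def m_assoc)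
      then show ?thesis using subgroup.one_closed [OF lcs_subgroup] by metis
    qed (rule comm_lcs_carrier comm_lcs_carrier'; assumption)+
  qed
  have F_le1: "F i = ?M" if "i \<le> 1" for i using that by (simp add: F_def)
  have F_ge2: "F i = lcs G (r + i - 1)" if "2 \<le> i" for i using that by (simp add: F_def)
  have lcs_F: "lcs G k \<subseteq> F i" if "r + i - 1 \<le> k" "r \<le> k" for i k
  proof (cases "i \<le> 1")
    case True
    then show ?thesis unfolding F_le1 [OF True] using lcsM lcs_antimono [OF that(2)] by blast
  next
    case False
    then show ?thesis using lcs_antimono [OF that(1)] by (simp add: F_ge2)
  qed
  interpret filtered_group G F p
  proof (intro filtered_group.intro filtered_group_axioms.intro is_group)
    show "subgroup (F i) G" for i
      unfolding F_def using generate_is_subgroup [OF A] lcs_subgroup by presburger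
    show "F (Suc i) \<subseteq> F i" for i
    proof (cases "i = 0")
      case True
      then show ?thesis by (simp add: F_le1)
    next
      case False
      then have "F (Suc i) = lcs G (r + Suc i - 1)" by (intro F_ge2) simp
      then show ?thesis using lcs_F [of i "r + Suc i - 1"] by simp
    qed
    have "F p = lcs G (r + p - 1)" using p2 by (rule F_ge2)
    moreover have "lcs G (r + p - 1) \<subseteq> {\<one>}"
      using lcs_antimono [of "p - 1" "r + p - 1"] nil p2 by simp
    moreover have "\<one> \<in> lcs G (r + p - 1)" by (rule subgroup.one_closed [OF lcs_subgroup])
    ultimately show "F p = {\<one>}" by blast
    show "comm G u v \<in> F (i + j)" if uv: "u \<in> F i" "v \<in> F j" for u v i j
    proof -
      have F_carrier: "x \<in> carrier G" if "x \<in> F i" for x i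
        using that Mc lcs_in_carrier unfolding F_def by (meson)
      consider "i \<le> 1" "j \<le> 1" | "i \<le> 1" "2 \<le> j" | "2 \<le> i" "j \<le> 1" | "2 \<le> i" "2 \<le> j" by linarith
      then show ?thesis
      proof cases
        case 1
        then have "comm G u v \<in> lcs G (Suc r)" using uv MM F_le1 by metis
        then show ?thesis
          by (rule subsetD [OF lcs_F, rotated 2]) (use 1 in linarith)+
      next
        case 2
        then have "comm G u v \<in> lcs G (Suc (r + j - 1))"
          using uv F_carrier F_ge2 comm_lcs_carrier by metis
        then show ?thesis
          by (rule subsetD [OF lcs_F, rotated 2]) (use 2 in linarith)+
      next
        case 3
        then have "comm G u v \<in> lcs G (Suc (r + i - 1))"
          using uv F_carrier F_ge2 comm_lcs_carrier' by metis
        then show ?thesis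
          by (rule subsetD [OF lcs_F, rotated 2]) (use 3 in linarith)+
      next
        case 4
        then have "comm G u v \<in> lcs G (Suc ((r + i - 1) + (r + j - 1)))"
          using uv F_ge2 comm_lcs_lcs by metis
        then show ?thesis
          by (rule subsetD [OF lcs_F, rotated 2]) (use 4 in linarith)+
      qed
    qed
  qed
  show ?thesis
  proof (rule pow_mult_filtered)
    show "a \<in> F 1" "b \<in> F 1" using a b by (simp_all add: F_def)
    show "p ^ e dvd p ^ e choose d" if "2 \<le> d" "d < p" for d
      using that p by (intro prime_power_dvd_choose) auto
    show "y [^] (p ^ e) = \<one>" if "y \<in> F 2" for y
      using that exp by (simp add: F_def del: lcs.simps)
  qed
qed

text \<open>Downward induction on \<open>r\<close> shows that \<open>lcs G r\<close> has exponent
  dividing \<open>p ^ e\<close>. The bound for \<open>lcs G (Suc r)\<close> makes the power map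
  multiplicative on \<open>lcs G r\<close>, so only generators need checking: commutators for
  \<open>r > 0\<close>, and \<open>A\<close> for \<open>r = 0\<close>.\<close>

theorem generate_exponent:
  fixes p :: nat
  assumes p: "Factorial_Ring.prime p" and nil: "lcs G (p - 1) = {\<one>}"
    and A: "A \<subseteq> carrier G" and gen: "generate G A = carrier G"
    and An: "\<And>x. x \<in> A \<Longrightarrow> x [^] (p ^ e) = \<one>"
    and a: "a \<in> carrier G"
  shows "a [^] (p ^ e) = \<one>"
proof -
  have "\<forall>y\<in>lcs G r. y [^] (p ^ e) = \<one>" if "r \<le> p - 1" for r
    using that
  proof (induction r rule: inc_induct)
    case base
    then show ?case using nil by simp
  next
    case (step r)
    let ?V = "{y \<in> lcs G r. y [^] (p ^ e) = \<one>}"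
    have mult: "(u \<otimes> v) [^] (p ^ e) = u [^] (p ^ e) \<otimes> v [^] (p ^ e)"
      if "x \<in> carrier G" "u \<in> generate G (insert x (lcs G r))"
        "v \<in> generate G (insert x (lcs G r))" for x u v
      using pow_mult_lcs [OF p nil _ that] step.IH by blast
    have incl: "y \<in> generate G (insert x (lcs G r))" if "y \<in> lcs G r" for x y
      using that by (simp add: generate.incl)
    have mult1: "(u \<otimes> v) [^] (p ^ e) = u [^] (p ^ e) \<otimes> v [^] (p ^ e)"
      if "u \<in> lcs G r" "v \<in> lcs G r" for u v
      using mult [OF one_closed] incl that by blast
    have V: "subgroup ?V G"
    proof
      show "?V \<subseteq> carrier G" using lcs_in_carrier by blast
      show "\<one> \<in> ?V" using subgroup.one_closed [OF lcs_subgroup] by simp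
      show "u \<otimes> v \<in> ?V" if "u \<in> ?V" "v \<in> ?V" for u v
        using that mult1 [of u v] subgroup.m_closed [OF lcs_subgroup] by simp
      show "inv u \<in> ?V" if "u \<in> ?V" for u
        using that subgroup.m_inv_closed [OF lcs_subgroup] lcs_in_carrier [of u r]
        by (simp add: nat_pow_inv)
    qed
    show ?case
    proof (cases r)
      case 0
      have "A \<subseteq> ?V" using 0 A An by auto
      then have "generate G A \<subseteq> ?V" using V generate_subgroup_incl by blast
      then show ?thesis using 0 gen by auto
    next
      case (Suc q)
      have comm: "comm G x y [^] (p ^ e) = \<one>" if "x \<in> carrier G" and y: "y \<in> lcs G q" for x y
      proof -
        have yc: "y \<in> carrier G" using y lcs_in_carrier by blast
        \<comment> \<open>The commutator is \<open>x\<close> times a conjugate of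
          \<open>inv x\<close>. Both have order dividing \<open>p ^ e\<close>, and both lie in the
          subgroup generated by \<open>x\<close> and \<open>lcs G r\<close>, on which the power map
          is multiplicative.\<close>
        have comm_gen: "comm G x y [^] (p ^ e) = \<one>" if "x \<in> A" for x
        proof -
          have x: "x \<in> carrier G" using that A by blast
          let ?M = "generate G (insert x (lcs G r))"
          have sub: "subgroup ?M G"
            using x lcs_in_carrier by (intro generate_is_subgroup) blast
          have xM: "x \<in> ?M" by (simp add: generate.incl)
          have "comm G x y \<in> ?M"
            using comm_lcs_carrier [OF x y] unfolding Suc by (intro generate.incl insertI2)
          then have "inv x \<otimes> comm G x y \<in> ?M"
            using xM by (intro subgroup.m_closed [OF sub] subgroup.m_inv_closed [OF sub])
          moreover have "inv x \<otimes> comm G x y = conjg G y (inv x)"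
            using x yc by (simp add: comm_def conjg_def m_assoc)
          ultimately have M: "conjg G y (inv x) \<in> ?M" by simp
          have "comm G x y = x \<otimes> conjg G y (inv x)"
            using x yc by (simp add: comm_def conjg_def m_assoc)
          moreover have "conjg G y (inv x) [^] (p ^ e) = \<one>"
            using x yc An [OF that] conjg_pow [of y "inv x" "p ^ e"] by (simp add: nat_pow_inv)
          ultimately show ?thesis using mult [OF x xM M] An [OF that] by simp
        qed
        have "x \<in> generate G A" using that gen by simp
        then show ?thesis
        proof (induction rule: generate.induct)
          case one
          then show ?case using yc by (simp add: comm_def)
        next
          case (incl x)
          then show ?case by (rule comm_gen)
        next
          case (inv x)
          then have x: "x \<in> carrier G" using A by blast
          then show ?case
            using comm_gen [OF inv] yc conjg_pow [of "inv x" "inv (comm G x y)" "p ^ e"]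
            by (simp add: comm_inv_left nat_pow_inv)
        next
          case (eng u v)
          then have uv: "u \<in> carrier G" "v \<in> carrier G" using A generate_in_carrier by auto
          have "conjg G u (comm G v y) \<in> lcs G r" "comm G u y \<in> lcs G r"
            unfolding Suc by (rule normal_conjg [OF lcs_normal uv(1) comm_lcs_carrier [OF uv(2) y]],
              rule comm_lcs_carrier [OF uv(1) y])
          then have "(conjg G u (comm G v y) \<otimes> comm G u y) [^] (p ^ e)
            = conjg G u (comm G v y) [^] (p ^ e) \<otimes> comm G u y [^] (p ^ e)"
            by (rule mult1)
          then show ?case
            using uv yc eng.IH conjg_pow [of u "comm G v y" "p ^ e"] by (simp add: comm_mult_left)
        qed
      qed
      have "{comm G x y | x y. x \<in> carrier G \<and> y \<in> lcs G q} \<subseteq> ?V"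
        unfolding Suc using comm comm_lcs_carrier by blast
      from generate_subgroup_incl [OF this V] have "lcs G r \<subseteq> ?V" by (simp add: Suc)
      then show ?thesis by blast
    qed
  qed
  from this [of 0] show ?thesis using a by simp
qed

end

section \<open>Exterior pairings\<close>

text \<open>An abstract stand-in for the semidirect product of \<open>G \<and> G\<close> and \<open>G\<close>, in which
  \<open>w g h\<close> is \<open>g \<and> h\<close> and \<open>\<iota>\<close> is the inclusion of \<open>G\<close>.\<close>
locale exterior_pairing = group S + G: group G
  for S (structure) and G :: "('b, 'c) monoid_scheme" +
  fixes \<iota> :: "'b \<Rightarrow> 'a" and w :: "'b \<Rightarrow> 'b \<Rightarrow> 'a"
  assumes \<iota>_hom: "\<iota> \<in> hom G S"
    and w_closed [simp]: "\<lbrakk>g \<in> carrier G; h \<in> carrier G\<rbrakk> \<Longrightarrow> w g h \<in> carrier S"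
    and generated: "generate S (\<iota> ` carrier G \<union> {w g h | g h. g \<in> carrier G \<and> h \<in> carrier G})
      = carrier S"
    and conjg_w: "\<lbrakk>g \<in> carrier G; x \<in> carrier G; y \<in> carrier G\<rbrakk>
      \<Longrightarrow> conjg S (\<iota> g) (w x y) = w (conjg G g x) (conjg G g y)"
    and w_left: "\<lbrakk>g \<in> carrier G; g' \<in> carrier G; h \<in> carrier G\<rbrakk>
      \<Longrightarrow> w (g \<otimes>\<^bsub>G\<^esub> g') h = w (conjg G g g') (conjg G g h) \<otimes> w g h"
    and w_right: "\<lbrakk>g \<in> carrier G; h \<in> carrier G; h' \<in> carrier G\<rbrakk>
      \<Longrightarrow> w g (h \<otimes>\<^bsub>G\<^esub> h') = w g h \<otimes> w (conjg G h g) (conjg G h h')"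
    and w_diag: "g \<in> carrier G \<Longrightarrow> w g g = \<one>"
begin

section \<open>Identities in the exterior square\<close>

lemma \<iota>_closed [simp]: "g \<in> carrier G \<Longrightarrow> \<iota> g \<in> carrier S"
  using \<iota>_hom hom_in_carrier by fastforce

sublocale \<iota>: group_hom G S \<iota>
  by unfold_locales (rule \<iota>_hom)

lemma \<iota>_conjg: "\<lbrakk>g \<in> carrier G; h \<in> carrier G\<rbrakk> \<Longrightarrow> \<iota> (conjg G g h) = conjg S (\<iota> g) (\<iota> h)"
  by (simp add: conjg_def)

lemma \<iota>_comm: "\<lbrakk>g \<in> carrier G; h \<in> carrier G\<rbrakk> \<Longrightarrow> \<iota> (comm G g h) = comm S (\<iota> g) (\<iota> h)"
  by (simp add: comm_def)

lemma w_mult_left: "\<lbrakk>g \<in> carrier G; g' \<in> carrier G; h \<in> carrier G\<rbrakk>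
    \<Longrightarrow> w (g \<otimes>\<^bsub>G\<^esub> g') h = conjg S (\<iota> g) (w g' h) \<otimes> w g h"
  by (simp add: w_left conjg_w)

lemma w_mult_right: "\<lbrakk>g \<in> carrier G; h \<in> carrier G; h' \<in> carrier G\<rbrakk>
    \<Longrightarrow> w g (h \<otimes>\<^bsub>G\<^esub> h') = w g h \<otimes> conjg S (\<iota> h) (w g h')"
  by (simp add: w_right conjg_w)

lemma w_one_left [simp]: "h \<in> carrier G \<Longrightarrow> w \<one>\<^bsub>G\<^esub> h = \<one>"
  using w_mult_left [of "\<one>\<^bsub>G\<^esub>" "\<one>\<^bsub>G\<^esub>" h] by simp

lemma w_one_right [simp]: "g \<in> carrier G \<Longrightarrow> w g \<one>\<^bsub>G\<^esub> = \<one>"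
  using w_mult_right [of g "\<one>\<^bsub>G\<^esub>" "\<one>\<^bsub>G\<^esub>"] by simp

lemma inv_w:
  assumes x: "x \<in> carrier G" and y: "y \<in> carrier G"
  shows "inv (w x y) = w y x"
proof -
  have "conjg S (\<iota> x) (w y x) \<otimes> conjg S (\<iota> x) (w x y) = w (x \<otimes>\<^bsub>G\<^esub> y) (x \<otimes>\<^bsub>G\<^esub> y)"
    using x y w_diag [OF x] w_diag [OF y]
    by (simp add: w_mult_left [of x y "x \<otimes>\<^bsub>G\<^esub> y"] w_mult_right [of x x y] w_mult_right [of y x y])
  also have "\<dots> = \<one>" using x y by (simp add: w_diag)
  finally have "conjg S (\<iota> x) (w y x \<otimes> w x y) = \<one>" using x y by (simp add: conjg_mult)
  then have "w y x \<otimes> w x y = \<one>"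
    using x y conjg_conjg [of "inv (\<iota> x)" "\<iota> x" "w y x \<otimes> w x y"] by simp
  then show ?thesis using x y inv_equality by simp
qed

text \<open>This is the crossed module property of \<open>g \<and> h \<mapsto> [g,h]\<close>.
  Expanding a product in both entries, left first or right first, gives the same outer factors, so
  the middle ones agree.\<close>

lemma w_conj_w:
  assumes c: "g \<in> carrier G" "h \<in> carrier G" "x \<in> carrier G" "y \<in> carrier G"
  shows "conjg S (w g h) (w x y) = conjg S (\<iota> (comm G g h)) (w x y)"
proof -
  let ?k = "h \<otimes>\<^bsub>G\<^esub> g"
  \<comment> \<open>The comparison relates conjugation by \<open>gh\<close> and by
    \<open>hg\<close>. Undoing \<open>hg\<close> beforehand leaves conjugation by
    \<open>comm G g h\<close> on \<open>w x y\<close>.\<close>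
  define x' where "x' = conjg G (inv\<^bsub>G\<^esub> ?k) x"
  define y' where "y' = conjg G (inv\<^bsub>G\<^esub> ?k) y"
  have c': "x' \<in> carrier G" "y' \<in> carrier G" using c by (simp_all add: x'_def y'_def)
  have xy: "w x y = conjg S (\<iota> ?k) (w x' y')"
    using c by (subst conjg_w) (simp_all add: x'_def y'_def G.conjg_conjg)
  have "conjg S (\<iota> g) (w x' h) \<otimes> (conjg S (\<iota> g) (conjg S (\<iota> h) (w x' y')) \<otimes> w g h
      \<otimes> conjg S (\<iota> h) (w g y')) = w (g \<otimes>\<^bsub>G\<^esub> x') (h \<otimes>\<^bsub>G\<^esub> y')"
    using c c' by (simp add: w_mult_left [of g x' "h \<otimes>\<^bsub>G\<^esub> y'"]
        w_mult_right [of x' h y'] w_mult_right [of g h y'] conjg_mult m_assoc)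
  also have "\<dots> = conjg S (\<iota> g) (w x' h) \<otimes> (w g h \<otimes> conjg S (\<iota> h) (conjg S (\<iota> g) (w x' y'))
      \<otimes> conjg S (\<iota> h) (w g y'))"
    using c c' by (simp add: w_mult_right [of "g \<otimes>\<^bsub>G\<^esub> x'" h y']
        w_mult_left [of g x' h] w_mult_left [of g x' y'] conjg_mult m_assoc)
  finally have "conjg S (\<iota> g) (conjg S (\<iota> h) (w x' y')) \<otimes> w g h
      = w g h \<otimes> conjg S (\<iota> h) (conjg S (\<iota> g) (w x' y'))"
    using c c' by simp
  then have "conjg S (\<iota> (g \<otimes>\<^bsub>G\<^esub> h)) (w x' y') \<otimes> w g h = w g h \<otimes> w x y"
    using c c' by (simp add: xy conjg_conjg)
  moreover have "conjg S (\<iota> (g \<otimes>\<^bsub>G\<^esub> h)) (w x' y') = conjg S (\<iota> (comm G g h)) (w x y)"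
    using c c' by (simp add: xy conjg_conjg comm_def m_assoc inv_mult_group)
  ultimately show ?thesis
    using c by (simp add: conjg_def [of S "w g h"] inv_solve_right')
qed

text \<open>With \<open>g'\<close> the conjugate of \<open>g\<close> by the inverse of
  \<open>x\<close>, the products \<open>g x\<close> and \<open>x g'\<close> agree; expanding their
  pairing with \<open>h\<close> in these two ways gives the identity, after \<open>w_conj_w\<close>
  removes a conjugation.\<close>

lemma comm_\<iota>_w:
  assumes c: "g \<in> carrier G" "x \<in> carrier G" "h \<in> carrier G"
  shows "comm S (\<iota> g) (w x h) = w g (comm G x h)"
proof -
  define g' where "g' = inv\<^bsub>G\<^esub> x \<otimes>\<^bsub>G\<^esub> g \<otimes>\<^bsub>G\<^esub> x"
  have g': "g' \<in> carrier G" "x \<otimes>\<^bsub>G\<^esub> g' = g \<otimes>\<^bsub>G\<^esub> x" "conjg G x g' = g"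
    using c by (simp_all add: g'_def conjg_def G.m_assoc)
  have xh: "conjg G x h = comm G x h \<otimes>\<^bsub>G\<^esub> h"
    using c by (simp add: comm_def conjg_def G.m_assoc)
  have "w g (conjg G x h) \<otimes> w x h = w (x \<otimes>\<^bsub>G\<^esub> g') h"
    using w_left [OF c(2) g'(1) c(3)] g'(3) by simp
  also have "\<dots> = conjg S (\<iota> g) (w x h) \<otimes> w g h"
    using w_mult_left [OF c] g'(2) by simp
  finally have 1: "w g (conjg G x h) \<otimes> w x h = conjg S (\<iota> g) (w x h) \<otimes> w g h" .
  have "w g (conjg G x h) = w g (comm G x h) \<otimes> conjg S (w x h) (w g h)"
    unfolding xh using c by (simp add: w_mult_right w_conj_w)
  then have "w g (conjg G x h) \<otimes> w x h = (w g (comm G x h) \<otimes> w x h) \<otimes> w g h"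
    using c by (simp add: conjg_def m_assoc)
  with 1 have "conjg S (\<iota> g) (w x h) = w g (comm G x h) \<otimes> w x h"
    using c by simp
  then have "conjg S (\<iota> g) (w x h) \<otimes> inv (w x h) = w g (comm G x h)"
    using c by (simp add: m_assoc)
  then show ?thesis by (simp add: conjg_def comm_def)
qed

lemma comm_w_\<iota>:
  assumes "x \<in> carrier G" "y \<in> carrier G" "h \<in> carrier G"
  shows "comm S (w x y) (\<iota> h) = w (comm G x y) h"
  using assms comm_\<iota>_w [of h x y] inv_comm [of "\<iota> h" "w x y"] inv_w [of h "comm G x y"] by simp

text \<open>Generators of a subgroup that will turn out to contain \<open>lcs S k\<close>. Elements
  \<open>w h x\<close> with \<open>h\<close> in the \<open>k\<close>-th term are covered as
  inverses, by \<open>inv_w\<close>.\<close>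

definition wgens :: "nat \<Rightarrow> 'a set" where
  "wgens k = \<iota> ` lcs G k \<union> {w x h | x h. x \<in> carrier G \<and> h \<in> lcs G k}"

lemma \<iota>_wgens: "h \<in> lcs G k \<Longrightarrow> \<iota> h \<in> wgens k"
  and w_wgens: "\<lbrakk>x \<in> carrier G; h \<in> lcs G k\<rbrakk> \<Longrightarrow> w x h \<in> wgens k"
  by (auto simp: wgens_def)

lemma wgens_cases:
  assumes "t \<in> wgens k"
  obtains h where "h \<in> lcs G k" "t = \<iota> h"
  | x h where "x \<in> carrier G" "h \<in> lcs G k" "t = w x h"
  using assms by (auto simp: wgens_def)

lemma wgens_carrier: "wgens k \<subseteq> carrier S"
  using G.lcs_in_carrier by (auto simp: wgens_def)

lemma generate_wgens_0: "generate S (wgens 0) = carrier S"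
  using generated by (simp add: wgens_def)

lemma wgens_0_inv: "t \<in> wgens 0 \<Longrightarrow> inv t \<in> wgens 0"
  by (erule wgens_cases) (auto simp: inv_w wgens_def simp flip: \<iota>.hom_inv)

text \<open>Conjugation by \<open>\<iota> g\<close> preserves the generating set. An element
  \<open>w x y\<close> acts on pairings like \<open>\<iota>\<close> of a commutator, and changes
  \<open>\<iota> h\<close> by the factor \<open>w (comm G x y) h\<close>, itself a
  generator.\<close>

lemma wgens_normal: "generate S (wgens k) \<lhd> S"
proof (rule normal_generate [OF wgens_carrier generate_wgens_0 wgens_0_inv wgens_carrier])
  fix s t assume s: "s \<in> wgens 0" and t: "t \<in> wgens k"
  note lcs = G.lcs_in_carrier G.normal_conjg [OF G.lcs_normal]
  have w_conj: "conjg S (\<iota> g) (w z h) \<in> wgens k"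
    if "g \<in> carrier G" "z \<in> carrier G" "h \<in> lcs G k" for g z h
    using that lcs by (auto simp: conjg_w intro: w_wgens)
  from s show "conjg S s t \<in> generate S (wgens k)"
  proof (cases rule: wgens_cases)
    case (1 g)
    then have g: "g \<in> carrier G" by simp
    from t have "conjg S s t \<in> wgens k"
    proof (cases rule: wgens_cases)
      case (1 h)
      then have "conjg S s t = \<iota> (conjg G g h)"
        using \<open>s = \<iota> g\<close> g lcs(1) \<iota>_conjg by simp
      then show ?thesis using \<iota>_wgens lcs(2) [OF g] 1 by simp
    next
      case (2 z h)
      then show ?thesis using w_conj \<open>s = \<iota> g\<close> g by simp
    qed
    then show ?thesis by (rule generate.incl)
  next
    case (2 x y)
    then have xy: "x \<in> carrier G" "y \<in> carrier G" by simp_all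
    from t show ?thesis
    proof (cases rule: wgens_cases)
      case (1 h)
      then have h: "h \<in> carrier G" using lcs(1) by blast
      have "conjg S s t = comm S s t \<otimes> t"
        using 1 2 xy h by (simp add: conjg_def comm_def m_assoc)
      moreover have "comm S s t \<in> wgens k"
        using 1 2 xy h by (simp add: comm_w_\<iota> w_wgens)
      ultimately show ?thesis using t by (simp add: generate.eng generate.incl)
    next
      case (2 z h)
      then have "conjg S s t = conjg S (\<iota> (comm G x y)) (w z h)"
        using \<open>s = w x y\<close> xy lcs(1) by (simp add: w_conj_w)
      then show ?thesis using w_conj 2 xy by (simp add: generate.incl)
    qed
  qed
qed

text \<open>The pairing identities settle all cases but that of \<open>w x y\<close> with
  \<open>\<iota> h\<close>: there \<open>comm_w_\<iota>\<close> yields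
  \<open>w (comm G x y) h\<close>, in which \<open>h\<close> has not moved to the next term. That
  case is computed from the action of \<open>h\<close> on \<open>w x y\<close>.\<close>

lemma comm_wgens:
  assumes s: "s \<in> wgens 0" and t: "t \<in> wgens k"
  shows "comm S s t \<in> generate S (wgens (Suc k))"
proof -
  let ?N = "generate S (wgens (Suc k))"
  note N = wgens_normal [of "Suc k"]
  note sub = normal_imp_subgroup [OF N]
  note lcs = G.lcs_in_carrier
  have wN: "w x h \<in> ?N" "w h x \<in> ?N" if "x \<in> carrier G" "h \<in> lcs G (Suc k)" for x h
  proof -
    show *: "w x h \<in> ?N" using that by (intro generate.incl w_wgens)
    show "w h x \<in> ?N" using subgroup.m_inv_closed [OF sub *] that lcs inv_w by metis
  qed
  have case_w: "comm S (\<iota> g) (w z h) \<in> ?N"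
    if "g \<in> carrier G" "z \<in> carrier G" "h \<in> lcs G k" for g z h
    using that lcs wN G.comm_lcs_carrier by (simp add: comm_\<iota>_w del: lcs.simps)
  from s show ?thesis
  proof (cases rule: wgens_cases)
    case (1 g)
    then have g: "g \<in> carrier G" by simp
    from t show ?thesis
    proof (cases rule: wgens_cases)
      case (1 h)
      then have "comm S s t = \<iota> (comm G g h)" using \<open>s = \<iota> g\<close> g lcs by (simp add: \<iota>_comm)
      then show ?thesis
        using 1 g G.comm_lcs_carrier by (auto intro!: generate.incl \<iota>_wgens simp del: lcs.simps)
    next
      case (2 z h)
      then show ?thesis using case_w \<open>s = \<iota> g\<close> g by simp
    qed
  next
    case (2 x y)
    then have xy: "x \<in> carrier G" "y \<in> carrier G" by simp_all
    from t show ?thesis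
    proof (cases rule: wgens_cases)
      case (1 h)
      have h: "h \<in> carrier G" using 1 lcs by blast
      \<comment> \<open>\<open>u\<close> and \<open>v\<close> measure how \<open>h\<close> moves
        \<open>x\<close> and \<open>y\<close>: conjugation by \<open>h\<close> multiplies them on
        the right by \<open>u\<close> and \<open>v\<close>, which lie in the next term.\<close>
      define u where "u = comm G (inv\<^bsub>G\<^esub> x) h"
      define v where "v = comm G (inv\<^bsub>G\<^esub> y) h"
      have uv: "u \<in> lcs G (Suc k)" "v \<in> lcs G (Suc k)"
        unfolding u_def v_def using G.comm_lcs_carrier 1 xy by (simp_all del: lcs.simps)
      then have uvc: "u \<in> carrier G" "v \<in> carrier G" using lcs by blast+
      have "conjg G h x = x \<otimes>\<^bsub>G\<^esub> u" "conjg G h y = y \<otimes>\<^bsub>G\<^esub> v"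
        using xy h by (simp_all add: u_def v_def comm_def conjg_def G.m_assoc)
      then have "conjg S t s = w (x \<otimes>\<^bsub>G\<^esub> u) (y \<otimes>\<^bsub>G\<^esub> v)"
        using 1 2 xy h by (simp add: conjg_w)
      also have "\<dots> = conjg S (\<iota> x) (w u (y \<otimes>\<^bsub>G\<^esub> v)) \<otimes> (s \<otimes> conjg S (\<iota> y) (w x v))"
        using xy uvc 2 by (simp add: w_mult_left [of x] w_mult_right [of x y v])
      finally have "conjg S t s = conjg S (\<iota> x) (w u (y \<otimes>\<^bsub>G\<^esub> v)) \<otimes> (s \<otimes> conjg S (\<iota> y) (w x v))" .
      moreover have "comm S t s = conjg S t s \<otimes> inv s"
        by (simp add: comm_def conjg_def)
      ultimately have "comm S t s
          = conjg S (\<iota> x) (w u (y \<otimes>\<^bsub>G\<^esub> v)) \<otimes> conjg S s (conjg S (\<iota> y) (w x v))"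
        using xy uvc 2 by (simp add: conjg_def [of S "w x y"] m_assoc)
      also have "\<dots> \<in> ?N"
        using xy uv uvc 2 wN normal_conjg [OF N] subgroup.m_closed [OF sub]
        by (simp del: lcs.simps)
      finally have "inv (comm S t s) \<in> ?N" using subgroup.m_inv_closed [OF sub] by blast
      then show ?thesis using inv_comm s t wgens_carrier by (metis subsetD)
    next
      case (2 z h)
      have "comm S s t = comm S (\<iota> (comm G x y)) t"
        using w_conj_w [of x y z h] 2 \<open>s = w x y\<close> xy lcs by (simp add: comm_def conjg_def)
      then show ?thesis using case_w 2 xy by simp
    qed
  qed
qed

lemma lcs_subset_wgens: "lcs S k \<subseteq> generate S (wgens k)"
proof (induction k)
  case 0
  then show ?case using generate_wgens_0 by simp
next
  case (Suc k)
  have "comm S x y \<in> generate S (wgens (Suc k))" if "x \<in> carrier S" "y \<in> lcs S k" for x y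
    using that Suc generate_wgens_0
    by (intro comm_generate [OF wgens_normal wgens_carrier wgens_carrier comm_wgens]) auto
  then have "{comm S x y | x y. x \<in> carrier S \<and> y \<in> lcs S k} \<subseteq> generate S (wgens (Suc k))"
    by blast
  then have "generate S {comm S x y | x y. x \<in> carrier S \<and> y \<in> lcs S k} \<subseteq> generate S (wgens (Suc k))"
    by (rule generate_subgroup_incl [OF _ normal_imp_subgroup [OF wgens_normal]])
  then show ?case by simp
qed

lemma lcs_trivial:
  assumes "lcs G k = {\<one>\<^bsub>G\<^esub>}"
  shows "lcs S k = {\<one>}"
proof -
  have "wgens k \<subseteq> {\<one>}" using assms by (auto simp: wgens_def)
  then have "generate S (wgens k) \<subseteq> {\<one>}"
    by (rule generate_subgroup_incl) (rule triv_subgroup)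
  then show ?thesis
    using lcs_subset_wgens [of k] subgroup.one_closed [OF lcs_subgroup [of k]] by blast
qed

text \<open>Each new factor \<open>y\<close> conjugates by \<open>\<iota> y\<close> and appends
  \<open>w y x\<close>; the trailing \<open>inv (\<iota> y)\<close> of the conjugation combines with
  \<open>w y x\<close> to form the repeated factor.\<close>

lemma w_pow_left:
  assumes "y \<in> carrier G" "x \<in> carrier G"
  shows "w (y [^]\<^bsub>G\<^esub> (n::nat)) x = \<iota> y [^] n \<otimes> (inv (\<iota> y) \<otimes> w y x) [^] n"
proof (induction n)
  case 0
  then show ?case using assms by simp
next
  case (Suc n)
  have "w (y [^]\<^bsub>G\<^esub> Suc n) x = w (y \<otimes>\<^bsub>G\<^esub> y [^]\<^bsub>G\<^esub> n) x"
    using assms by (simp only: G.nat_pow_Suc2)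
  also have "\<dots> = \<iota> y \<otimes> (\<iota> y [^] n \<otimes> (inv (\<iota> y) \<otimes> w y x) [^] n) \<otimes> inv (\<iota> y) \<otimes> w y x"
    using assms Suc by (simp add: w_mult_left conjg_def)
  also have "\<dots> = \<iota> y [^] Suc n \<otimes> (inv (\<iota> y) \<otimes> w y x) [^] Suc n"
    using assms by (subst nat_pow_Suc2) (simp_all add: m_assoc)
  finally show ?case .
qed

text \<open>If \<open>y\<close> has order dividing \<open>n\<close>, then so has \<open>\<iota> y\<inverse> \<cdot> (y \<and> x)\<close>, because \<open>y\<^sup>n \<and> x = 1\<close>;
  these elements and \<open>\<iota> G\<close> generate the whole group.\<close>
theorem exterior_exponent:
  fixes p :: nat
  assumes p: "Factorial_Ring.prime p" and nil: "lcs G (p - 1) = {\<one>\<^bsub>G\<^esub>}"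
    and exp: "\<And>g. g \<in> carrier G \<Longrightarrow> g [^]\<^bsub>G\<^esub> (p ^ e) = \<one>\<^bsub>G\<^esub>"
    and s: "s \<in> carrier S"
  shows "s [^] (p ^ e) = \<one>"
proof -
  define A where
    "A = \<iota> ` carrier G \<union> {inv (\<iota> y) \<otimes> w y x | x y. x \<in> carrier G \<and> y \<in> carrier G}"
  have A: "A \<subseteq> carrier S" by (auto simp: A_def)
  have \<iota>n: "\<iota> g [^] (p ^ e) = \<one>" if "g \<in> carrier G" for g
    using that exp by (simp flip: \<iota>.hom_nat_pow)
  have "w y x \<in> generate S A" if "x \<in> carrier G" "y \<in> carrier G" for x y
  proof -
    have "\<iota> y \<in> A" "inv (\<iota> y) \<otimes> w y x \<in> A" using that by (auto simp: A_def)
    then have "\<iota> y \<otimes> (inv (\<iota> y) \<otimes> w y x) \<in> generate S A"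
      by (intro generate.eng [OF generate.incl generate.incl])
    then show ?thesis using that by simp
  qed
  moreover have "\<iota> g \<in> generate S A" if "g \<in> carrier G" for g
    using that by (intro generate.incl) (simp add: A_def)
  ultimately have "wgens 0 \<subseteq> generate S A"
    by (auto simp: wgens_def)
  then have "carrier S \<subseteq> generate S A"
    using generate_subgroup_incl [OF _ generate_is_subgroup [OF A]] generate_wgens_0 by metis
  then have "generate S A = carrier S" using generate_incl [OF A] by (rule equalityI [rotated])
  moreover have "a [^] (p ^ e) = \<one>" if "a \<in> A" for a
  proof -
    have "(inv (\<iota> y) \<otimes> w y x) [^] (p ^ e) = \<one>" if "x \<in> carrier G" "y \<in> carrier G" for x y
      using w_pow_left [OF that(2,1), of "p ^ e"] that exp \<iota>n by simp
    then show ?thesis using that \<iota>n by (auto simp: A_def)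
  qed
  ultimately show ?thesis
    using generate_exponent [OF p lcs_trivial [OF nil] A] s by blast
qed

end

section \<open>The semidirect product of the exterior square with the group\<close>

lemma tword_append [simp]: "tword G (u @ v) \<longleftrightarrow> tword G u \<and> tword G v"
  by (simp add: tword_def ball_Un)

lemma tword_Nil [simp]: "tword G []"
  by (simp add: tword_def)

lemma tword_Cons [simp]:
  "tword G ((x, y, b) # w) \<longleftrightarrow> x \<in> carrier G \<and> y \<in> carrier G \<and> tword G w"
  by (simp add: tword_def)

lemma ext_eq_append:
  assumes "ext_eq G u u'" "ext_eq G v v'" shows "ext_eq G (u @ v) (u' @ v')"
  by (rule ext_eq.trans [of G _ "u' @ v"])
    (use ext_eq.cong [OF assms(1), of "[]" v] ext_eq.cong [OF assms(2), of u' "[]"] in simp_all)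

definition tw_inv :: "'a tword \<Rightarrow> 'a tword" where
  "tw_inv w = rev (map (\<lambda>(x, y, b). (x, y, \<not> b)) w)"

definition tw_act :: "('a, 'b) monoid_scheme \<Rightarrow> 'a \<Rightarrow> 'a tword \<Rightarrow> 'a tword" where
  "tw_act G g w = map (\<lambda>(x, y, b). (conjg G g x, conjg G g y, b)) w"

lemma tw_act_simps [simp]:
  "tw_act G g [] = []"
  "tw_act G g ((x, y, b) # w) = (conjg G g x, conjg G g y, b) # tw_act G g w"
  "tw_act G g (u @ v) = tw_act G g u @ tw_act G g v"
  by (simp_all add: tw_act_def)

lemma tw_inv_simps [simp]:
  "tw_inv [] = []"
  "tw_inv ((x, y, b) # w) = tw_inv w @ [(x, y, \<not> b)]"
  by (simp_all add: tw_inv_def)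

lemma tword_tw_inv [simp]: "tword G (tw_inv w) = tword G w"
  by (induction w) auto

lemma tw_inv_cancel: "tword G w \<Longrightarrow> ext_eq G (tw_inv w @ w) []"
proof (induction w)
  case Nil
  show ?case by (simp add: ext_eq.refl)
next
  case (Cons a w)
  obtain x y b where a: "a = (x, y, b)" by (cases a)
  have "ext_eq G (tw_inv w @ [(x, y, \<not> b), (x, y, \<not> \<not> b)] @ w) (tw_inv w @ [] @ w)"
    using Cons.prems a by (intro ext_eq.cong ext_eq.cancel) simp_all
  then show ?case using Cons a by (auto intro: ext_eq.trans)
qed

context group
begin

lemma tword_tw_act [simp]: "\<lbrakk>g \<in> carrier G; tword G w\<rbrakk> \<Longrightarrow> tword G (tw_act G g w)"
  by (induction w) auto

lemma tw_act_one [simp]: "tword G w \<Longrightarrow> tw_act G \<one> w = w"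
  by (induction w) auto

lemma tw_act_mult: "\<lbrakk>g \<in> carrier G; h \<in> carrier G; tword G w\<rbrakk>
    \<Longrightarrow> tw_act G g (tw_act G h w) = tw_act G (g \<otimes> h) w"
  by (induction w) (auto simp: conjg_conjg)

lemma conjg_conjg_conjg:
  "\<lbrakk>g \<in> carrier G; x \<in> carrier G; y \<in> carrier G\<rbrakk>
    \<Longrightarrow> conjg G g (conjg G x y) = conjg G (conjg G g x) (conjg G g y)"
  by (simp add: conjg_def m_assoc inv_mult_group)

text \<open>Conjugation is an automorphism of \<open>G\<close>, so every defining relation goes to
  one of the same shape. This makes the action on the exterior square well defined.\<close>

lemma ext_eq_tw_act:
  assumes g: "g \<in> carrier G" and uv: "ext_eq G u v"
  shows "ext_eq G (tw_act G g u) (tw_act G g v)"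
  using uv
proof (induction rule: ext_eq.induct)
  case (sym u v)
  from sym.IH show ?case by (rule ext_eq.sym)
next
  case (trans u v w)
  from trans.IH show ?case by (rule ext_eq.trans)
next
  case (rel_left x x' y)
  then show ?case
    using g ext_eq.rel_left [of "conjg G g x" G "conjg G g x'" "conjg G g y"]
      conjg_conjg_conjg [of g x x'] conjg_conjg_conjg [of g x y]
    by (simp add: conjg_mult)
next
  case (rel_right x y y')
  then show ?case
    using g ext_eq.rel_right [of "conjg G g x" G "conjg G g y" "conjg G g y'"]
      conjg_conjg_conjg [of g y x] conjg_conjg_conjg [of g y y']
    by (simp add: conjg_mult)
qed (use g in \<open>simp_all add: ext_eq.refl ext_eq.cong ext_eq.cancel ext_eq.diag\<close>)

end

section \<open>Construction of the semidirect product\<close>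

definition ext_class :: "('a, 'b) monoid_scheme \<Rightarrow> 'a tword \<Rightarrow> 'a tword set" where
  "ext_class G w = {v. ext_eq G w v}"

lemma ext_class_eq_iff: "ext_class G u = ext_class G v \<longleftrightarrow> ext_eq G u v"
  unfolding ext_class_def by (blast intro: ext_eq.refl ext_eq.sym ext_eq.trans)

text \<open>The product collects the results over all representatives, which avoids choosing any;
  \<open>mult_ext_semidirect\<close> shows that one pair of representatives suffices.
  \<open>ext_eq\<close> is reflexive on words with letters outside \<open>G\<close> too, hence the
  restriction by \<open>tword\<close>.\<close>

definition ext_semidirect :: "('a, 'b) monoid_scheme \<Rightarrow> ('a tword set \<times> 'a) monoid" where
  "ext_semidirect G =
    \<lparr>carrier = {(ext_class G w, g) | w g. tword G w \<and> g \<in> carrier G},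
     monoid.mult = (\<lambda>(A, g) (B, h).
       ({c. \<exists>a\<in>A. \<exists>b\<in>B. ext_eq G (a @ tw_act G g b) c}, g \<otimes>\<^bsub>G\<^esub> h)),
     monoid.one = (ext_class G [], \<one>\<^bsub>G\<^esub>)\<rparr>"

lemma one_ext_semidirect: "\<one>\<^bsub>ext_semidirect G\<^esub> = (ext_class G [], \<one>\<^bsub>G\<^esub>)"
  by (simp add: ext_semidirect_def)

lemma carrier_ext_semidirect [simp]:
  "(ext_class G w, g) \<in> carrier (ext_semidirect G)" if "tword G w" "g \<in> carrier G"
  using that by (auto simp: ext_semidirect_def)

lemma ext_semidirect_cases:
  assumes "s \<in> carrier (ext_semidirect G)"
  obtains w g where "tword G w" "g \<in> carrier G" "s = (ext_class G w, g)"
  using assms by (auto simp: ext_semidirect_def)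

context group
begin

lemma mult_ext_semidirect:
  assumes "g \<in> carrier G"
  shows "(ext_class G u, g) \<otimes>\<^bsub>ext_semidirect G\<^esub> (ext_class G v, h)
    = (ext_class G (u @ tw_act G g v), g \<otimes> h)"
proof -
  have "{c. \<exists>a\<in>ext_class G u. \<exists>b\<in>ext_class G v. ext_eq G (a @ tw_act G g b) c}
    = ext_class G (u @ tw_act G g v)"
  proof (rule equalityI; rule subsetI)
    fix c assume "c \<in> {c. \<exists>a\<in>ext_class G u. \<exists>b\<in>ext_class G v. ext_eq G (a @ tw_act G g b) c}"
    then obtain a b where "ext_eq G u a" "ext_eq G v b" "ext_eq G (a @ tw_act G g b) c"
      by (auto simp: ext_class_def)
    then show "c \<in> ext_class G (u @ tw_act G g v)"
      using ext_eq.trans [OF ext_eq_append [OF _ ext_eq_tw_act [OF assms]]]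
      by (simp add: ext_class_def)
  next
    fix c assume "c \<in> ext_class G (u @ tw_act G g v)"
    then show "c \<in> {c. \<exists>a\<in>ext_class G u. \<exists>b\<in>ext_class G v. ext_eq G (a @ tw_act G g b) c}"
      by (auto simp: ext_class_def intro: ext_eq.refl)
  qed
  then show ?thesis by (simp add: ext_semidirect_def)
qed

lemma group_ext_semidirect: "group (ext_semidirect G)"
proof (rule groupI)
  fix s t r
  assume "s \<in> carrier (ext_semidirect G)" "t \<in> carrier (ext_semidirect G)"
  then show "s \<otimes>\<^bsub>ext_semidirect G\<^esub> t \<in> carrier (ext_semidirect G)"
    by (elim ext_semidirect_cases) (simp add: mult_ext_semidirect)
  assume "r \<in> carrier (ext_semidirect G)"
  with \<open>s \<in> _\<close> \<open>t \<in> _\<close> show "s \<otimes>\<^bsub>ext_semidirect G\<^esub> t \<otimes>\<^bsub>ext_semidirect G\<^esub> r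
      = s \<otimes>\<^bsub>ext_semidirect G\<^esub> (t \<otimes>\<^bsub>ext_semidirect G\<^esub> r)"
    by (elim ext_semidirect_cases) (simp add: mult_ext_semidirect tw_act_mult m_assoc)
next
  show "\<one>\<^bsub>ext_semidirect G\<^esub> \<in> carrier (ext_semidirect G)"
    by (simp add: one_ext_semidirect)
next
  fix s assume "s \<in> carrier (ext_semidirect G)"
  then obtain w g where s: "tword G w" "g \<in> carrier G" "s = (ext_class G w, g)"
    by (rule ext_semidirect_cases)
  then show "\<one>\<^bsub>ext_semidirect G\<^esub> \<otimes>\<^bsub>ext_semidirect G\<^esub> s = s"
    by (simp add: one_ext_semidirect mult_ext_semidirect)
  let ?t = "(ext_class G (tw_act G (inv g) (tw_inv w)), inv g)"
  have "ext_eq G (tw_act G (inv g) (tw_inv w @ w)) (tw_act G (inv g) [])"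
    using s by (intro ext_eq_tw_act tw_inv_cancel) simp_all
  then have "?t \<otimes>\<^bsub>ext_semidirect G\<^esub> s = \<one>\<^bsub>ext_semidirect G\<^esub>"
    using s by (simp add: one_ext_semidirect mult_ext_semidirect ext_class_eq_iff)
  moreover have "?t \<in> carrier (ext_semidirect G)" using s by simp
  ultimately show "\<exists>t\<in>carrier (ext_semidirect G).
      t \<otimes>\<^bsub>ext_semidirect G\<^esub> s = \<one>\<^bsub>ext_semidirect G\<^esub>"
    by blast
qed

text \<open>Second component \<open>\<one>\<close> acts trivially, so these pairs multiply by
  concatenation. This carries the exponent bound back to words.\<close>

lemma pow_ext_semidirect:
  assumes "tword G w"
  shows "(ext_class G w, \<one>) [^]\<^bsub>ext_semidirect G\<^esub> n = (ext_class G (tw_pow w n), \<one>)"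
proof -
  interpret S: group "ext_semidirect G" by (rule group_ext_semidirect)
  have tw: "tword G (tw_pow w n)" for n
    using assms by (induction n) (simp_all add: tw_pow_def)
  show ?thesis
  proof (induction n)
    case 0
    show ?case by (simp add: tw_pow_def one_ext_semidirect)
  next
    case (Suc n)
    have "(ext_class G w, \<one>) [^]\<^bsub>ext_semidirect G\<^esub> Suc n
      = (ext_class G w, \<one>) \<otimes>\<^bsub>ext_semidirect G\<^esub> (ext_class G w, \<one>) [^]\<^bsub>ext_semidirect G\<^esub> n"
      using assms by (intro S.nat_pow_Suc2) simp
    then show ?case using Suc tw by (simp add: mult_ext_semidirect tw_pow_def)
  qed
qed

lemma exterior_pairing_ext_semidirect:
  "exterior_pairing (ext_semidirect G) G (\<lambda>g. (ext_class G [], g))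
    (\<lambda>x y. (ext_class G [(x, y, True)], \<one>))"
proof -
  interpret S: group "ext_semidirect G" by (rule group_ext_semidirect)
  let ?S = "ext_semidirect G"
  let ?i = "\<lambda>g. (ext_class G [], g)"
  let ?w = "\<lambda>x y. (ext_class G [(x, y, True)], \<one>)"
  note mult = mult_ext_semidirect
  have hom: "?i \<in> hom G ?S" by (rule homI) (simp_all add: mult)
  have inv_i: "inv\<^bsub>?S\<^esub> (?i g) = ?i (inv g)" if "g \<in> carrier G" for g
    using that by (intro S.inv_equality) (simp_all add: mult one_ext_semidirect)
  have inv_w: "inv\<^bsub>?S\<^esub> (?w x y) = (ext_class G [(x, y, False)], \<one>)"
    if "x \<in> carrier G" "y \<in> carrier G" for x y
    using that ext_eq.cancel [of x G y False]
    by (intro S.inv_equality) (simp_all add: mult one_ext_semidirect ext_class_eq_iff)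
  let ?A = "?i ` carrier G \<union> {?w g h | g h. g \<in> carrier G \<and> h \<in> carrier G}"
  have A: "?A \<subseteq> carrier ?S" by auto
  note sub = S.generate_is_subgroup [OF A]
  have word: "(ext_class G v, \<one>) \<in> generate ?S ?A" if "tword G v" for v
    using that
  proof (induction v)
    case Nil
    have "?i \<one> \<in> ?A" by simp
    then show ?case by (rule generate.incl)
  next
    case (Cons a v)
    obtain x y b where a: "a = (x, y, b)" by (cases a)
    then have xy: "x \<in> carrier G" "y \<in> carrier G" "tword G v" using Cons.prems by simp_all
    have "?w x y \<in> ?A" using xy by blast
    then have "?w x y \<in> generate ?S ?A" by (rule generate.incl)
    moreover from this have "(ext_class G [(x, y, False)], \<one>) \<in> generate ?S ?A"
      using subgroup.m_inv_closed [OF sub, of "?w x y"] unfolding inv_w [OF xy(1,2)] by blast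
    ultimately have "(ext_class G [a], \<one>) \<in> generate ?S ?A" using a by (cases b) simp_all
    from generate.eng [OF this Cons.IH [OF xy(3)]]
    show ?case using xy by (simp add: mult)
  qed
  have "s \<in> generate ?S ?A" if s_carrier: "s \<in> carrier ?S" for s
  proof -
    obtain v g where s: "tword G v" "g \<in> carrier G" "s = (ext_class G v, g)"
      using s_carrier by (rule ext_semidirect_cases)
    have "?i g \<in> ?A" using s by blast
    from generate.eng [OF word [OF s(1)] generate.incl [OF this]]
    show ?thesis using s by (simp add: mult)
  qed
  then have gen: "generate ?S ?A = carrier ?S"
    using S.generate_incl [OF A] by blast
  have conj: "conjg ?S (?i g) (?w x y) = ?w (conjg G g x) (conjg G g y)"
    if "g \<in> carrier G" "x \<in> carrier G" "y \<in> carrier G" for g x y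
    using that by (simp add: conjg_def [of ?S] inv_i mult)
  show ?thesis
    by (intro exterior_pairing.intro exterior_pairing_axioms.intro group_ext_semidirect is_group
        hom gen conj)
      (simp_all add: mult ext_class_eq_iff one_ext_semidirect ext_eq.rel_left ext_eq.rel_right
        ext_eq.diag)
qed

section \<open>The exponent of a p-group and the conclusion\<close>

lemma grp_exp_p_group:
  fixes p :: nat
  assumes p: "Factorial_Ring.prime p" and G: "p_group p G"
  shows "\<exists>e. grp_exp G = p ^ e" and "x \<in> carrier G \<Longrightarrow> x [^] grp_exp G = \<one>"
proof -
  obtain k where fin: "finite (carrier G)" and k: "order G = p ^ k"
    using G by (auto simp: p_group_def order_def)
  define P where "P = (\<lambda>n::nat. 0 < n \<and> (\<forall>x\<in>carrier G. x [^] n = \<one>))"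
  have e: "grp_exp G = (LEAST n. P n)" by (simp add: grp_exp_def P_def)
  have k0: "0 < p ^ k" using p prime_gt_0_nat by simp
  have Pk: "P (p ^ k)"
    unfolding P_def using k0 pow_order_eq_1 k by metis
  then have n: "P (grp_exp G)" unfolding e by (rule LeastI)
  then show "x \<in> carrier G \<Longrightarrow> x [^] grp_exp G = \<one>" by (simp add: P_def)
  \<comment> \<open>The remainder of the group order modulo the exponent also annihilates every
    element, so minimality forces it to be 0; a divisor of \<open>p ^ k\<close> is a power of
    \<open>p\<close>.\<close>
  let ?n = "grp_exp G" and ?r = "p ^ k mod grp_exp G"
  have "x [^] ?r = \<one>" if "x \<in> carrier G" for x
  proof -
    have "x [^] (p ^ k) = x [^] (?n * (p ^ k div ?n) + ?r)" by simp
    also have "\<dots> = (x [^] ?n) [^] (p ^ k div ?n) \<otimes> x [^] ?r"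
      using that by (simp only: nat_pow_mult nat_pow_pow nat_pow_closed)
    finally show ?thesis using that n Pk by (simp add: P_def)
  qed
  moreover have "?r < ?n" using n by (simp add: P_def)
  ultimately have "?r = 0" using not_less_Least [of ?r P] by (auto simp: e P_def)
  then have "?n dvd p ^ k" by (simp add: mod_eq_0_iff_dvd)
  then show "\<exists>e. grp_exp G = p ^ e" using p divides_primepow_nat by blast
qed

end

theorem theorem4p6:
  fixes G :: "('a, 'b) monoid_scheme" and p :: nat
  assumes "Factorial_Ring.prime p" and "odd p"
    and "group G" and "p_group p G"
    and "nilpotent_class_le G (p - 1)"
  shows "(\<forall>w. tword G w \<longrightarrow> ext_eq G (tw_pow w (grp_exp G)) [])
       \<and> (\<forall>w. tword G w \<and> kappa G w = \<one>\<^bsub>G\<^esub> \<longrightarrow> ext_eq G (tw_pow w (grp_exp G)) [])"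
proof -
  interpret group G by fact
  interpret E: exterior_pairing "ext_semidirect G" G "\<lambda>g. (ext_class G [], g)"
    "\<lambda>x y. (ext_class G [(x, y, True)], \<one>\<^bsub>G\<^esub>)"
    by (rule exterior_pairing_ext_semidirect)
  obtain e where e: "grp_exp G = p ^ e"
    using grp_exp_p_group(1) [OF assms(1,4)] by blast
  have "ext_eq G (tw_pow w (grp_exp G)) []" if w: "tword G w" for w
  proof -
    have "(ext_class G w, \<one>\<^bsub>G\<^esub>) [^]\<^bsub>ext_semidirect G\<^esub> (p ^ e) = \<one>\<^bsub>ext_semidirect G\<^esub>"
    proof (rule E.exterior_exponent [OF assms(1)])
      show "lcs G (p - 1) = {\<one>\<^bsub>G\<^esub>}" using assms(5) by (simp add: nilpotent_class_le_def)
      show "g [^]\<^bsub>G\<^esub> (p ^ e) = \<one>\<^bsub>G\<^esub>" if "g \<in> carrier G" for g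
        using grp_exp_p_group(2) [OF assms(1,4) that] e by simp
      show "(ext_class G w, \<one>\<^bsub>G\<^esub>) \<in> carrier (ext_semidirect G)" using w by simp
    qed
    then have "ext_class G (tw_pow w (p ^ e)) = ext_class G []"
      unfolding pow_ext_semidirect [OF w] one_ext_semidirect by (rule Pair_inject)
    then show ?thesis unfolding e ext_class_eq_iff .
  qed
  then show ?thesis by blast
qed

end
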